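(* Let $K$ be a field of characteristic $0$. Let $\sigma\in \mathrm{GA}_3(K)\setminus \mathrm{Aff}_3(K)$ be a non affine automorphism such that $\sigma(z)=z$ and $\sigma(y)\in \mathcal{R}^2(K[z])$. Then $\sigma$ is co-tame.
   Context: $\mathrm{GA}_3(K)$ is the group of automorphisms of the $K$-algebra $K[x,y,z]$. $\mathrm{Aff}_3(K)$ is the subgroup of affine automorphisms ($\sigma(x),\sigma(y),\sigma(z)$ all of degree $1$). $\mathrm{BA}_3(K)$ is the subgroup of triangular automorphisms ($\sigma(x)\in K^*x+K[y,z]$, $\sigma(y)\in K^*y+K[z]$, $\sigma(z)\in K^*z+K$). $\mathrm{TA}_3(K)$, the group of tame automorphisms, is the subgroup generated by $\mathrm{Aff}_3(K)$ and $\mathrm{BA}_3(K)$. An automorphism $\sigma\in \mathrm{GA}_3(K)$ is called co-tame if $\mathrm{TA}_3(K)$ is contained in the subgroup of $\mathrm{GA}_3(K)$ generated by $\mathrm{Aff}_3(K)$ and $\sigma$. $\mathcal{R}^2(K[z])$ is the set of polynomials $F\in K[z][x,y]=K[x,y,z]$ of the form $F=p_2y+Q_2(p_1x+Q_1(y))$ with $p_1,p_2\in K(z)\setminus\{0\}$ and $Q_1,Q_2\in K(z)[y]$. *)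

theory Defs
  imports
    "HOL-Computational_Algebra.Polynomial_Factorial"
    "HOL-Algebra.Generated_Groups"
begin

text \<open>
  The ring $K[x,y,z]$ is the iterated polynomial ring $K[z][y][x]$: the outermost variable is $x$,
  the innermost one is $z$. Thus a polynomial in $K[y,z]$ is embedded as \<open>[:p:]\<close>, one in
  $K[z]$ as \<open>[:[:p:]:]\<close>, and a constant as \<open>[:[:[:c:]:]:]\<close>.
\<close>

type_synonym 'k poly3 = "'k poly poly poly"

definition varX :: "'k::field poly3" where
  "varX = [:0, 1:]"

definition varY :: "'k::field poly3" where
  "varY = [:[:0, 1:]:]"

definition varZ :: "'k::field poly3" where
  "varZ = [:[:[:0, 1:]:]:]"

definition const3 :: "'k::field \<Rightarrow> 'k poly3" where
  "const3 c = [:[:[:c:]:]:]"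

definition coeff3 :: "'k::field poly3 \<Rightarrow> nat \<Rightarrow> nat \<Rightarrow> nat \<Rightarrow> 'k" where
  "coeff3 F i j k = coeff (coeff (coeff F i) j) k"

text \<open>The total degree in $x,y,z$, with the zero polynomial given degree 0.\<close>

definition total_degree :: "'k::field poly3 \<Rightarrow> nat" where
  "total_degree F = Max (insert 0 {i + j + k | i j k. coeff3 F i j k \<noteq> 0})"

lemma finite_total_degree_set: "finite {i + j + k | i j k. coeff3 F i j k \<noteq> 0}"
proof -
  have "{i + j + k | i j k. coeff3 F i j k \<noteq> 0} \<subseteq>
    (\<Union>i\<in>{..degree F}. \<Union>j\<in>{..degree (coeff F i)}.
      (\<lambda>k. i + j + k) ` {..degree (coeff (coeff F i) j)})"
  proof
    fix n assume "n \<in> {i + j + k | i j k. coeff3 F i j k \<noteq> 0}"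
    then obtain i j k where n: "n = i + j + k" and nz: "coeff3 F i j k \<noteq> 0" by blast
    have "coeff (coeff F i) j \<noteq> 0" "coeff F i \<noteq> 0"
      using nz by (auto simp: coeff3_def)
    with nz have "i \<le> degree F" "j \<le> degree (coeff F i)" "k \<le> degree (coeff (coeff F i) j)"
      by (auto simp: coeff3_def intro: le_degree)
    with n show "n \<in> (\<Union>i\<in>{..degree F}. \<Union>j\<in>{..degree (coeff F i)}.
      (\<lambda>k. i + j + k) ` {..degree (coeff (coeff F i) j)})" by blast
  qed
  then show ?thesis by (rule finite_subset) auto
qed

definition is_algebra_aut :: "('k::field poly3 \<Rightarrow> 'k poly3) \<Rightarrow> bool" where
  "is_algebra_aut \<sigma> \<longleftrightarrow>
     bij \<sigma> \<and>
     (\<forall>F G. \<sigma> (F + G) = \<sigma> F + \<sigma> G) \<and>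
     (\<forall>F G. \<sigma> (F * G) = \<sigma> F * \<sigma> G) \<and>
     (\<forall>c. \<sigma> (const3 c) = const3 c)"

definition GA3 :: "('k::field poly3 \<Rightarrow> 'k poly3) monoid" where
  "GA3 = \<lparr>carrier = {\<sigma>. is_algebra_aut \<sigma>}, mult = (\<circ>), one = id\<rparr>"

lemma is_algebra_aut_inv:
  assumes "is_algebra_aut \<sigma>"
  shows "is_algebra_aut (inv_into UNIV \<sigma>)"
proof -
  have b: "bij \<sigma>" using assms by (simp add: is_algebra_aut_def)
  have r: "\<sigma> (inv_into UNIV \<sigma> F) = F" for F
    using b by (simp add: bij_is_surj surj_f_inv_f)
  have l: "inv_into UNIV \<sigma> F = G" if "\<sigma> G = F" for F G
    using b that by (auto simp: bij_is_inj)
  show ?thesis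
    using assms unfolding is_algebra_aut_def
    by (auto simp: bij_imp_bij_inv r intro!: l)
qed

lemma group_GA3: "group (GA3 :: ('k::field poly3 \<Rightarrow> 'k poly3) monoid)"
proof (rule groupI)
  fix \<sigma> :: "'k poly3 \<Rightarrow> 'k poly3"
  assume "\<sigma> \<in> carrier GA3"
  then have a: "is_algebra_aut \<sigma>" by (simp add: GA3_def)
  then have "inv_into UNIV \<sigma> \<circ> \<sigma> = id"
    by (auto simp: is_algebra_aut_def bij_is_inj)
  with is_algebra_aut_inv[OF a] show "\<exists>\<tau>\<in>carrier GA3. \<tau> \<otimes>\<^bsub>GA3\<^esub> \<sigma> = \<one>\<^bsub>GA3\<^esub>"
    by (auto simp: GA3_def)
qed (auto simp: GA3_def is_algebra_aut_def bij_comp comp_assoc)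

definition Aff3 :: "('k::field poly3 \<Rightarrow> 'k poly3) set" where
  "Aff3 = {\<sigma> \<in> carrier GA3.
     total_degree (\<sigma> varX) = 1 \<and> total_degree (\<sigma> varY) = 1 \<and> total_degree (\<sigma> varZ) = 1}"

definition BA3 :: "('k::field poly3 \<Rightarrow> 'k poly3) set" where
  "BA3 = {\<sigma> \<in> carrier GA3.
     (\<exists>a p. a \<noteq> 0 \<and> \<sigma> varX = const3 a * varX + [:p:]) \<and>
     (\<exists>b q. b \<noteq> 0 \<and> \<sigma> varY = const3 b * varY + [:[:q:]:]) \<and>
     (\<exists>c r. c \<noteq> 0 \<and> \<sigma> varZ = const3 c * varZ + const3 r)}"

definition TA3 :: "('k::field poly3 \<Rightarrow> 'k poly3) set" where
  "TA3 = generate GA3 (Aff3 \<union> BA3)"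

definition co_tame :: "('k::field poly3 \<Rightarrow> 'k poly3) \<Rightarrow> bool" where
  "co_tame \<sigma> \<longleftrightarrow> \<sigma> \<in> carrier GA3 \<and> TA3 \<subseteq> generate GA3 (insert \<sigma> Aff3)"

text \<open>
  The set $\mathcal{R}^2(K[z])$. The identity $F = p_2 y + Q_2(p_1 x + Q_1(y))$ is stated in
  $K(z)[y][x]$, where \<open>[:[:0, p2:]:]\<close> is $p_2 y$ and \<open>[:Q1, [:p1:]:]\<close> is $p_1 x + Q_1(y)$.
\<close>

definition R2 :: "'k::field poly3 set" where
  "R2 = {F. \<exists>(p1 :: 'k poly fract) p2 Q1 Q2. p1 \<noteq> 0 \<and> p2 \<noteq> 0 \<and>
     map_poly (map_poly to_fract) F =
       [:[:0, p2:]:] + poly (map_poly (\<lambda>c. [:[:c:]:]) Q2) [:Q1, [:p1:]:]}"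

end

theory Submission
  imports Defs
begin

text \<open>
  Let $H$ be the group generated by $\sigma$ and the affine automorphisms, and let $S$ be the set of
  $P \in K[y,z]$ with $(x+P,y,z) \in H$. Then $S$ is a $K$-space which is stable under diagonal
  scalings, hence spanned by monomials, and under every $(x, y+r(z), z)$ with $r \in S$. As soon as
  $S$ has an element of degree at least 2 it therefore contains $z^2$ and $yz$, then all $z^n$ by
  $yz \mapsto (y+z^n)z$, hence everything. Every triangular element of $H$ that fixes $z$ puts its two
  components into $S$, so it suffices to find a non-affine one.

  Clearing denominators, $m\,\sigma(y) = n y + Q(g)$ with $g = p x + q(y)$ and $m, n, p \in K[z]$. Let
  $G = \sigma^{-1}(g)$ and let $T_u$ be the translation $x \mapsto x+u(z)$. A comparison of degrees in
  $x$ gives $G = c x + q'(y)$. If $\deg Q \ge 2$, then in the coordinates $(G, y)$ over $K(z)$ the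
  automorphism $\sigma^{-1}T_u\sigma$ is a translation of $G$ together with $y \mapsto y + W(G)$, and
  commutators with the $T_v$ are iterated differences of $W$. They end with $y \mapsto y + b(z)v^d$, where
  $d = \deg Q$ and $v \in \{1,z\}$; taking $v = z$ gives degree at least 2. If $\deg Q \le 1$, then
  either $\sigma^{-1}T_z\sigma$ or the product of $\sigma$ and an affine automorphism is triangular and
  not affine.
\<close>

section \<open>Homomorphisms of the polynomial ring\<close>

definition zpoly :: "'k::field poly \<Rightarrow> 'k poly3" where
  "zpoly r = [:[:r:]:]"

lemma zpoly_simps [simp]:
  "zpoly 0 = 0" "zpoly 1 = 1" "zpoly (r + s) = zpoly r + zpoly s"
  "zpoly (r - s) = zpoly r - zpoly s" "zpoly (- r) = - zpoly r"
  "zpoly (r * s) = zpoly r * zpoly s" "zpoly r = zpoly s \<longleftrightarrow> r = s" "zpoly r = 0 \<longleftrightarrow> r = 0"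
  by (simp_all add: zpoly_def one_pCons)

lemma zpoly_power: "zpoly (r ^ n) = zpoly r ^ n"
  by (induction n) simp_all

lemma zpoly_const: "zpoly [:c:] = const3 c"
  by (simp add: zpoly_def const3_def)

lemma zpoly_Z: "zpoly [:0, 1:] = varZ"
  by (simp add: zpoly_def varZ_def)

lemma const3_simps [simp]:
  "const3 0 = 0" "const3 1 = 1" "const3 (a + b) = const3 a + const3 b"
  "const3 (a - b) = const3 a - const3 b" "const3 (- a) = - const3 a"
  "const3 (a * b) = const3 a * const3 b" "const3 a = const3 b \<longleftrightarrow> a = b"
  by (simp_all add: const3_def one_pCons)

lemma const3_inverse [simp]: "a \<noteq> 0 \<Longrightarrow> const3 (inverse a) * (const3 a * F) = F"
  "a \<noteq> 0 \<Longrightarrow> const3 a * (const3 (inverse a) * F) = F"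
  by (metis const3_simps(2,6) left_inverse right_inverse mult.assoc mult_1)+

lemma zpoly_induct [consumes 0, case_names const Z add mult]:
  assumes "\<And>c. P (const3 c)" "P varZ"
    and "\<And>F G. P F \<Longrightarrow> P G \<Longrightarrow> P (F + G)" "\<And>F G. P F \<Longrightarrow> P G \<Longrightarrow> P (F * G)"
  shows "P (zpoly r)"
proof (induction r)
  case 0
  then show ?case using assms(1)[of 0] by simp
next
  case (pCons a p)
  have "zpoly (pCons a p) = const3 a + varZ * zpoly p"
    by (simp add: zpoly_def const3_def varZ_def)
  then show ?case using pCons assms by simp
qed

lemma yzpoly_induct [consumes 0, case_names const Y Z add mult]:
  assumes "\<And>c. P (const3 c)" "P varY" "P varZ"
    and "\<And>F G. P F \<Longrightarrow> P G \<Longrightarrow> P (F + G)" "\<And>F G. P F \<Longrightarrow> P G \<Longrightarrow> P (F * G)"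
  shows "P [:p:]"
proof (induction p)
  case 0
  then show ?case using assms(1)[of 0] by simp
next
  case (pCons a p)
  have "[:pCons a p:] = zpoly a + varY * [:p:]"
    by (simp add: zpoly_def varY_def)
  moreover have "P (zpoly a)" by (rule zpoly_induct) (use assms in auto)
  ultimately show ?case using pCons(2) assms(2,4,5) by metis
qed

lemma poly3_induct [consumes 0, case_names const X Y Z add mult]:
  assumes "\<And>c. P (const3 c)" "P varX" "P varY" "P varZ"
    and "\<And>F G. P F \<Longrightarrow> P G \<Longrightarrow> P (F + G)" "\<And>F G. P F \<Longrightarrow> P G \<Longrightarrow> P (F * G)"
  shows "P F"
proof (induction F)
  case 0
  then show ?case using assms(1)[of 0] by simp
next
  case (pCons a p)
  have "pCons a p = [:a:] + varX * p"
    by (simp add: varX_def)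
  moreover have "P [:a:]" by (rule yzpoly_induct) (use assms in auto)
  ultimately show ?case using pCons(2) assms(2,5,6) by metis
qed

locale alg_hom =
  fixes \<phi> :: "'k::field poly3 \<Rightarrow> 'k poly3"
  assumes add [simp]: "\<phi> (F + G) = \<phi> F + \<phi> G"
    and mult [simp]: "\<phi> (F * G) = \<phi> F * \<phi> G"
    and const [simp]: "\<phi> (const3 c) = const3 c"
begin

lemma zero [simp]: "\<phi> 0 = 0"
  using const[of 0] by simp

lemma one [simp]: "\<phi> 1 = 1"
  using const[of 1] by simp

lemma minus [simp]: "\<phi> (- F) = - \<phi> F"
  using add[of F "- F"] by (simp add: add_eq_0_iff)

lemma diff [simp]: "\<phi> (F - G) = \<phi> F - \<phi> G"
  using add[of F "- G"] by simp

lemma power [simp]: "\<phi> (F ^ n) = \<phi> F ^ n"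
  by (induction n) simp_all

lemma sum: "\<phi> (sum f A) = (\<Sum>i\<in>A. \<phi> (f i))"
  by (induction A rule: infinite_finite_induct) simp_all

lemma zpoly: "\<phi> varZ = varZ \<Longrightarrow> \<phi> (zpoly r) = zpoly r"
  by (rule zpoly_induct) simp_all

end

lemma alg_hom_eqI:
  assumes "alg_hom \<phi>" "alg_hom \<psi>" "\<phi> varX = \<psi> varX" "\<phi> varY = \<psi> varY" "\<phi> varZ = \<psi> varZ"
  shows "\<phi> = \<psi>"
proof
  interpret \<phi>: alg_hom \<phi> by fact
  interpret \<psi>: alg_hom \<psi> by fact
  fix F
  show "\<phi> F = \<psi> F"
    by (induction F rule: poly3_induct) (simp_all add: assms)
qed

lemma alg_hom_comp: "alg_hom \<phi> \<Longrightarrow> alg_hom \<psi> \<Longrightarrow> alg_hom (\<phi> \<circ> \<psi>)"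
  by (simp add: alg_hom_def)

lemma alg_hom_id: "alg_hom id"
  by (simp add: alg_hom_def)

lemma is_algebra_aut_iff: "is_algebra_aut \<phi> \<longleftrightarrow> alg_hom \<phi> \<and> bij \<phi>"
  by (auto simp: is_algebra_aut_def alg_hom_def)

text \<open>Mapping coefficients by a homomorphism and then evaluating is again a homomorphism.
  Three nested uses of this, one per variable, give \<open>alg_hom_subst\<close>.\<close>

lemma poly_map_poly_add:
  fixes f :: "'a::comm_semiring_0 \<Rightarrow> 'b::comm_semiring_1"
  assumes "f 0 = 0" "\<And>a b. f (a + b) = f a + f b"
  shows "poly (map_poly f (p + q)) c = poly (map_poly f p) c + poly (map_poly f q) c"
proof (induction p q rule: poly_induct2)
  case 0
  show ?case by simp
next
  case (pCons a p b q)
  then show ?case by (simp add: map_poly_pCons assms algebra_simps)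
qed

lemma poly_map_poly_mult:
  fixes f :: "'a::comm_semiring_1 \<Rightarrow> 'b::comm_semiring_1"
  assumes "f 0 = 0" "\<And>a b. f (a + b) = f a + f b" "\<And>a b. f (a * b) = f a * f b"
  shows "poly (map_poly f (p * q)) c = poly (map_poly f p) c * poly (map_poly f q) c"
proof (induction p)
  case 0
  show ?case by simp
next
  case (pCons a p)
  have smult: "poly (map_poly f (smult a q)) c = f a * poly (map_poly f q) c"
    by (induction q) (simp_all add: map_poly_pCons assms algebra_simps)
  have "poly (map_poly f (pCons a p * q)) c
      = poly (map_poly f (smult a q + pCons 0 (p * q))) c"
    by (simp add: mult_pCons_left)
  also have "\<dots> = f a * poly (map_poly f q) c + c * poly (map_poly f (p * q)) c"
    by (simp add: poly_map_poly_add assms smult map_poly_pCons)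
  finally show ?case by (simp add: pCons map_poly_pCons assms algebra_simps)
qed

text \<open>Evaluation follows the nesting of the ring: innermost \<open>z\<close> becomes
  \<open>C\<close>, then \<open>y\<close> becomes \<open>B\<close>, and last \<open>x\<close>
  becomes \<open>A\<close>.\<close>

definition subst :: "'k::field poly3 \<Rightarrow> 'k poly3 \<Rightarrow> 'k poly3 \<Rightarrow> 'k poly3 \<Rightarrow> 'k poly3" where
  "subst A B C F =
     poly (map_poly (\<lambda>p. poly (map_poly (\<lambda>q. poly (map_poly const3 q) C) p) B) F) A"

lemma alg_hom_subst: "alg_hom (subst A B C)"
  unfolding subst_def
  by standard (simp_all add: poly_map_poly_add poly_map_poly_mult const3_def map_poly_pCons)

lemma subst_vars [simp]:
  "subst A B C varX = A" "subst A B C varY = B" "subst A B C varZ = C"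
  by (simp_all add: subst_def varX_def varY_def varZ_def map_poly_pCons)

lemmas subst_simps [simp] =
  alg_hom.add [OF alg_hom_subst] alg_hom.mult [OF alg_hom_subst] alg_hom.const [OF alg_hom_subst]
  alg_hom.minus [OF alg_hom_subst] alg_hom.diff [OF alg_hom_subst]

lemma is_algebra_aut_subst:
  assumes "subst A B C A' = varX" "subst A B C B' = varY" "subst A B C C' = varZ"
    and "subst A' B' C' A = varX" "subst A' B' C' B = varY" "subst A' B' C' C = varZ"
  shows "is_algebra_aut (subst A B C)"
proof -
  have "subst A B C \<circ> subst A' B' C' = id" "subst A' B' C' \<circ> subst A B C = id"
    by (rule alg_hom_eqI; simp add: assms alg_hom_comp alg_hom_subst alg_hom_id)+
  then show ?thesis
    by (simp add: is_algebra_aut_iff alg_hom_subst o_bij)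
qed

section \<open>Affine automorphisms\<close>

text \<open>Degree at most 1, with constants and 0 included: unlike degree exactly 1, this is closed
  under linear combinations.\<close>

definition lin :: "'k::field poly3 \<Rightarrow> bool" where
  "lin F \<longleftrightarrow> (\<forall>i j k. coeff3 F i j k \<noteq> 0 \<longrightarrow> i + j + k \<le> 1)"

lemma coeff3_add [simp]: "coeff3 (F + G) i j k = coeff3 F i j k + coeff3 G i j k"
  by (simp add: coeff3_def)

lemma coeff3_const_mult [simp]: "coeff3 (const3 c * F) i j k = c * coeff3 F i j k"
  by (simp add: coeff3_def const3_def)

lemma coeff3_yz: "coeff3 [:p:] i j k = (if i = 0 then coeff (coeff p j) k else 0)"
  by (cases i) (simp_all add: coeff3_def)

lemma coeff3_zpoly: "coeff3 (zpoly r) i j k = (if i = 0 \<and> j = 0 then coeff r k else 0)"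
  by (cases j) (simp_all add: zpoly_def coeff3_yz)

lemma lin_add: "lin F \<Longrightarrow> lin G \<Longrightarrow> lin (F + G)"
  unfolding lin_def by (metis coeff3_add add.right_neutral)

lemma lin_const_mult: "lin F \<Longrightarrow> lin (const3 c * F)"
  by (auto simp: lin_def)

lemma lin_const_mult_iff: "c \<noteq> 0 \<Longrightarrow> lin (const3 c * F) \<longleftrightarrow> lin F"
  by (auto simp: lin_def)

lemma lin_uminus: "lin F \<Longrightarrow> lin (- F)"
  using lin_const_mult[of F "-1"] by simp

lemma lin_diff: "lin F \<Longrightarrow> lin G \<Longrightarrow> lin (F - G)"
  using lin_add[OF _ lin_uminus, of F G] by simp

lemma lin_basic: "lin (const3 c)" "lin varX" "lin varY" "lin varZ" "lin 0"
proof -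
  show "lin (const3 c)"
    by (auto simp: lin_def coeff3_zpoly zpoly_const [symmetric] coeff_pCons split: nat.splits)
  show "lin varX" "lin varY" "lin varZ" "lin 0"
    by (auto simp: lin_def coeff3_def varX_def varY_def varZ_def coeff_pCons split: nat.splits)
qed

lemmas lin_intros = lin_basic lin_add lin_diff lin_uminus lin_const_mult

lemma total_degree_le_1_iff: "total_degree F \<le> 1 \<longleftrightarrow> lin F"
proof -
  let ?D = "{i + j + k | i j k. coeff3 F i j k \<noteq> 0}"
  have "total_degree F \<le> 1 \<longleftrightarrow> (\<forall>n\<in>insert 0 ?D. n \<le> 1)"
    unfolding total_degree_def
    by (rule Max_le_iff) (simp_all only: finite_insert finite_total_degree_set insert_not_empty not_False_eq_True)
  also have "\<dots> \<longleftrightarrow> (\<forall>n\<in>?D. n \<le> 1)" by simp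
  also have "\<dots> \<longleftrightarrow> lin F"
    unfolding lin_def Ball_def mem_Collect_eq by metis
  finally show ?thesis .
qed

lemma total_degree_eq_0:
  assumes "total_degree F = 0"
  shows "F = const3 (coeff3 F 0 0 0)"
proof -
  let ?D = "{i + j + k | i j k. coeff3 F i j k \<noteq> 0}"
  have le: "n \<le> 0" if "n \<in> ?D" for n
  proof -
    have "n \<le> Max (insert 0 ?D)"
      by (rule Max_ge) (use that in \<open>simp_all only: finite_insert finite_total_degree_set insert_iff simp_thms\<close>)
    then show ?thesis using assms by (simp only: total_degree_def)
  qed
  have "coeff3 F i j k = 0" if "i + j + k > 0" for i j k
  proof (rule ccontr)
    assume "coeff3 F i j k \<noteq> 0"
    then have "i + j + k \<le> 0" by (intro le) blast
    with that show False by simp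
  qed
  moreover have "coeff3 (const3 c) i j k = (if i + j + k = 0 then c else 0)" for c :: 'a and i j k
    by (simp add: coeff3_def const3_def coeff_pCons split: nat.split)
  ultimately have "coeff3 F i j k = coeff3 (const3 c) i j k" if "c = coeff3 F 0 0 0" for i j k c
    using that by auto
  then show ?thesis unfolding coeff3_def by (intro poly_eqI) blast
qed

lemma var_neq_const [simp]: "varX \<noteq> const3 c" "varY \<noteq> const3 c" "varZ \<noteq> const3 c"
  by (simp_all add: varX_def varY_def varZ_def const3_def)

text \<open>Degree 0 cannot occur: constants are fixed and the map is injective, so no variable is
  sent to a constant.\<close>

lemma Aff3I:
  assumes "is_algebra_aut \<phi>" "lin (\<phi> varX)" "lin (\<phi> varY)" "lin (\<phi> varZ)"
  shows "\<phi> \<in> Aff3"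
proof -
  interpret hom: alg_hom \<phi> using assms(1) by (simp add: is_algebra_aut_iff)
  have pos: "total_degree (\<phi> v) \<noteq> 0" if "\<And>c. v \<noteq> const3 c" for v
  proof
    assume "total_degree (\<phi> v) = 0"
    then have "\<phi> v = \<phi> (const3 (coeff3 (\<phi> v) 0 0 0))"
      by (simp only: hom.const) (rule total_degree_eq_0)
    moreover have "inj \<phi>" using assms(1) by (simp add: is_algebra_aut_def bij_is_inj)
    ultimately have "v = const3 (coeff3 (\<phi> v) 0 0 0)"
      by (rule injD [rotated])
    with that show False by blast
  qed
  then have "total_degree (\<phi> v) = 1" if "\<And>c. v \<noteq> const3 c" "lin (\<phi> v)" for v
  proof -
    have "total_degree (\<phi> v) \<le> 1" using that(2) by (simp only: total_degree_le_1_iff)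
    with pos[OF that(1)] show ?thesis
      by linarith
  qed
  then show ?thesis using assms by (simp add: Aff3_def GA3_def)
qed

lemma Aff3_subst:
  assumes "subst A B C A' = varX" "subst A B C B' = varY" "subst A B C C' = varZ"
    and "subst A' B' C' A = varX" "subst A' B' C' B = varY" "subst A' B' C' C = varZ"
    and "lin A" "lin B" "lin C"
  shows "subst A B C \<in> Aff3"
  using assms by (intro Aff3I is_algebra_aut_subst[of A B C A' B' C']) simp_all


section \<open>Elementary automorphisms in an overgroup of the affine group\<close>

definition yz :: "'k::field poly3 \<Rightarrow> bool" where
  "yz F \<longleftrightarrow> (\<exists>p. F = [:p:])"

lemma yz_pCons [simp]: "yz [:p:]"
  by (auto simp: yz_def)

lemma yz_zpoly [simp]: "yz (zpoly r)"
  by (simp add: zpoly_def)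

lemma yz_const [simp]: "yz (const3 c)"
  by (simp add: const3_def)

lemma yz_vars [simp]: "yz varY" "yz varZ"
  by (simp_all add: varY_def varZ_def)

lemma yz_0 [simp]: "yz 0"
  using yz_const[of 0] by simp

lemma yz_ring [simp, intro]:
  assumes "yz F" "yz G"
  shows "yz (F + G)" "yz (F - G)" "yz (F * G)"
proof -
  obtain p q where "F = [:p:]" "G = [:q:]" using assms by (auto simp: yz_def)
  then have "F + G = [:p + q:]" "F - G = [:p - q:]" "F * G = [:p * q:]" by simp_all
  then show "yz (F + G)" "yz (F - G)" "yz (F * G)" unfolding yz_def by blast+
qed

lemma yz_uminus [simp, intro]: "yz F \<Longrightarrow> yz (- F)"
  using yz_ring(2)[of 0 F] by simp

lemma yz_iff_degree: "yz F \<longleftrightarrow> degree F = 0"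
  by (auto simp: yz_def elim: degree_eq_zeroE)

lemma yz_mult_cancel: "yz (F * G) \<Longrightarrow> F \<noteq> 0 \<Longrightarrow> yz G"
  by (cases "G = 0") (auto simp: yz_iff_degree degree_mult_eq)

context alg_hom
begin

lemma yz_image:
  assumes "yz (\<phi> varY)" "yz (\<phi> varZ)" "yz F"
  shows "yz (\<phi> F)"
proof -
  have "yz (\<phi> [:p:])" for p
    by (rule yzpoly_induct) (use assms in auto)
  then show ?thesis using assms(3) by (auto simp: yz_def)
qed

lemma yz_fixed:
  assumes "\<phi> varY = varY" "\<phi> varZ = varZ" "yz F"
  shows "\<phi> F = F"
proof -
  have "\<phi> [:p:] = [:p:]" for p
    by (rule yzpoly_induct) (use assms in auto)
  then show ?thesis using assms(3) by (auto simp: yz_def)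
qed

end

definition elem :: "'k::field poly3 \<Rightarrow> 'k poly3 \<Rightarrow> 'k poly3" where
  "elem P = subst (varX + P) varY varZ"

lemma alg_hom_elem: "alg_hom (elem P)"
  by (simp add: elem_def alg_hom_subst)

lemma elem_vars [simp]: "elem P varX = varX + P" "elem P varY = varY" "elem P varZ = varZ"
  by (simp_all add: elem_def)

lemma elem_yz [simp]: "yz F \<Longrightarrow> elem P F = F"
  using alg_hom.yz_fixed[OF alg_hom_elem, of P F] by simp

lemmas elem_simps [simp] =
  alg_hom.add [OF alg_hom_elem] alg_hom.mult [OF alg_hom_elem] alg_hom.const [OF alg_hom_elem]

lemma elem_comp:
  assumes "yz P" "yz Q"
  shows "elem P \<circ> elem Q = elem (P + Q)"
  by (rule alg_hom_eqI) (simp_all add: assms alg_hom_comp alg_hom_elem add_ac)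

lemma elem_0: "elem 0 = id"
  by (rule alg_hom_eqI) (simp_all add: alg_hom_elem alg_hom_id)

lemma is_algebra_aut_elem:
  assumes "yz P"
  shows "is_algebra_aut (elem P)"
proof -
  have "elem P \<circ> elem (- P) = id" "elem (- P) \<circ> elem P = id"
    using assms by (simp_all add: elem_comp elem_0)
  then show ?thesis by (simp add: is_algebra_aut_iff alg_hom_elem o_bij)
qed

lemma elem_Aff: "yz P \<Longrightarrow> lin P \<Longrightarrow> elem P \<in> Aff3"
  by (intro Aff3I is_algebra_aut_elem) (simp_all add: lin_intros)

definition swap_xy :: "'k::field poly3 \<Rightarrow> 'k poly3" where
  "swap_xy = subst varY varX varZ"

definition swap_yz :: "'k::field poly3 \<Rightarrow> 'k poly3" where
  "swap_yz = subst varX varZ varY"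

text \<open>What remains of a triangular automorphism after its shears in \<open>x\<close> and
  \<open>y\<close> are split off; the translation in \<open>z\<close> therefore has to be
  kept.\<close>

definition diag :: "'k \<Rightarrow> 'k \<Rightarrow> 'k \<Rightarrow> 'k \<Rightarrow> 'k::field poly3 \<Rightarrow> 'k poly3" where
  "diag a b c r = subst (const3 a * varX) (const3 b * varY) (const3 c * varZ + const3 r)"

lemma diag_vars [simp]: "diag a b c r varX = const3 a * varX" "diag a b c r varY = const3 b * varY"
  "diag a b c r varZ = const3 c * varZ + const3 r"
  by (simp_all add: diag_def)

lemma swap_vars [simp]:
  "swap_xy varX = varY" "swap_xy varY = varX" "swap_xy varZ = varZ"
  "swap_yz varX = varX" "swap_yz varY = varZ" "swap_yz varZ = varY"
  by (simp_all add: swap_xy_def swap_yz_def)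

lemma alg_hom_affine: "alg_hom swap_xy" "alg_hom swap_yz" "alg_hom (diag a b c r)"
  by (simp_all add: swap_xy_def swap_yz_def diag_def alg_hom_subst)

lemmas affine_simps [simp] =
  alg_hom.add [OF alg_hom_affine(1)] alg_hom.mult [OF alg_hom_affine(1)]
  alg_hom.const [OF alg_hom_affine(1)]
  alg_hom.add [OF alg_hom_affine(2)] alg_hom.mult [OF alg_hom_affine(2)]
  alg_hom.const [OF alg_hom_affine(2)]
  alg_hom.add [OF alg_hom_affine(3)] alg_hom.mult [OF alg_hom_affine(3)]
  alg_hom.const [OF alg_hom_affine(3)]

lemma swap_Aff: "swap_xy \<in> Aff3" "swap_yz \<in> Aff3"
  unfolding swap_xy_def swap_yz_def
  by (rule Aff3_subst[where A' = varY and B' = varX and C' = varZ]; simp add: lin_intros)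
    (rule Aff3_subst[where A' = varX and B' = varZ and C' = varY]; simp add: lin_intros)

lemma diag_Aff:
  assumes "a \<noteq> 0" "b \<noteq> 0" "c \<noteq> 0"
  shows "diag a b c r \<in> Aff3"
  unfolding diag_def
  by (rule Aff3_subst[where A' = "const3 (inverse a) * varX" and B' = "const3 (inverse b) * varY"
        and C' = "const3 (inverse c) * (varZ - const3 r)"])
    (simp_all add: lin_intros assms)

lemma inv_GA3:
  assumes "is_algebra_aut \<phi>"
  shows "inv\<^bsub>GA3\<^esub> \<phi> = inv_into UNIV \<phi>"
proof (rule group.inv_equality[OF group_GA3])
  show "inv_into UNIV \<phi> \<otimes>\<^bsub>GA3\<^esub> \<phi> = \<one>\<^bsub>GA3\<^esub>"
    using assms by (simp add: GA3_def is_algebra_aut_def bij_is_inj)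
qed (use assms is_algebra_aut_inv in \<open>auto simp: GA3_def\<close>)

text \<open>\<open>H\<close> will be the group generated by \<sigma> and \<open>Aff3\<close>.
  Characteristic 0 supplies distinct powers of 2, nonzero binomial coefficients and nonzero integer
  factors in differences of polynomials.\<close>

locale overgroup =
  fixes H :: "('k::field_char_0 poly3 \<Rightarrow> 'k poly3) set"
  assumes subgroup: "subgroup H GA3" and Aff: "Aff3 \<subseteq> H"
begin

lemma aut: "\<phi> \<in> H \<Longrightarrow> is_algebra_aut \<phi>"
  using subgroup.subset[OF subgroup] by (auto simp: GA3_def)

lemma hom: "\<phi> \<in> H \<Longrightarrow> alg_hom \<phi>"
  using aut by (simp add: is_algebra_aut_iff)

lemma comp: "\<phi> \<in> H \<Longrightarrow> \<psi> \<in> H \<Longrightarrow> \<phi> \<circ> \<psi> \<in> H"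
  using subgroup.m_closed[OF subgroup] by (simp add: GA3_def)

lemma inv_closed: "\<phi> \<in> H \<Longrightarrow> inv_into UNIV \<phi> \<in> H"
  using subgroup.m_inv_closed[OF subgroup] inv_GA3[OF aut] by metis

lemma inv_comp: "\<phi> \<in> H \<Longrightarrow> inv_into UNIV \<phi> \<circ> \<phi> = id" "\<phi> \<in> H \<Longrightarrow> \<phi> \<circ> inv_into UNIV \<phi> = id"
  using aut[of \<phi>] by (simp_all add: is_algebra_aut_def bij_is_inj bij_is_surj surj_iff [symmetric])

lemma cancel_right:
  assumes "\<phi> \<circ> \<psi> \<in> H" "\<psi> \<in> H"
  shows "\<phi> \<in> H"
  using comp[OF assms(1) inv_closed[OF assms(2)]] inv_comp[OF assms(2)] by (simp add: comp_assoc)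

lemma cancel_left:
  assumes "\<phi> \<circ> \<psi> \<in> H" "\<phi> \<in> H"
  shows "\<psi> \<in> H"
  using comp[OF inv_closed[OF assms(2)] assms(1)] inv_comp[OF assms(2)]
  by (simp add: comp_assoc [symmetric])

lemma conjugate:
  assumes "\<phi> \<in> H" "\<rho> \<in> H" "\<phi> \<circ> \<rho> = \<rho>' \<circ> \<phi>"
  shows "\<rho>' \<in> H"
  using comp[OF assms(1,2)] assms(1,3) by (intro cancel_right[of \<rho>' \<phi>]) simp_all

definition S :: "'k poly3 set" where
  "S = {P. yz P \<and> elem P \<in> H}"

lemma S_yz: "P \<in> S \<Longrightarrow> yz P"
  by (simp add: S_def)

lemma S_lin: "yz P \<Longrightarrow> lin P \<Longrightarrow> P \<in> S"
  using elem_Aff Aff by (auto simp: S_def)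

lemma S_add: "P \<in> S \<Longrightarrow> Q \<in> S \<Longrightarrow> P + Q \<in> S"
  by (auto simp: S_def elem_comp [symmetric] comp)

lemma S_0: "0 \<in> S"
  using S_lin[of 0] by (simp add: lin_basic)

text \<open>As \<open>A\<close> fixes \<open>x\<close> and preserves K[y,z], conjugating the shear
  \<open>elem P\<close> by \<open>A\<close> gives the shear \<open>elem (A P)\<close>.\<close>

lemma S_conj:
  assumes "A \<in> H" "A varX = varX" "yz (A varY)" "yz (A varZ)" "P \<in> S"
  shows "A P \<in> S"
proof -
  interpret A: alg_hom A using assms(1) by (rule hom)
  have P: "yz P" "elem P \<in> H" using assms(5) by (simp_all add: S_def)
  have yz: "yz (A P)" by (rule A.yz_image[OF assms(3,4) P(1)])
  have "A \<circ> elem P = elem (A P) \<circ> A"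
    by (rule alg_hom_eqI)
      (simp_all add: assms(2-4) yz alg_hom_comp alg_hom_elem A.alg_hom_axioms)
  then have "elem (A P) \<in> H" by (rule conjugate[OF assms(1) P(2)])
  with yz show ?thesis by (simp add: S_def)
qed

text \<open>For nonzero \<open>c\<close>, conjugation by the affine map sending \<open>x\<close> to
  \<open>x/c\<close> multiplies the shear by \<open>c\<close>.\<close>

lemma S_scale:
  assumes "P \<in> S"
  shows "const3 c * P \<in> S"
proof (cases "c = 0")
  case True
  then show ?thesis by (simp add: S_0)
next
  case False
  let ?A = "diag (inverse c) 1 1 0"
  have P: "yz P" "elem P \<in> H" using assms by (simp_all add: S_def)
  have A: "?A \<in> H" using diag_Aff[of "inverse c" 1 1 0] False Aff by auto
  have "?A P = P"
    by (rule alg_hom.yz_fixed) (simp_all add: alg_hom_affine P)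
  then have "?A \<circ> elem P = elem (const3 c * P) \<circ> ?A"
    using P False
    by - (rule alg_hom_eqI, simp_all add: alg_hom_comp alg_hom_elem alg_hom_affine distrib_left)
  then have "elem (const3 c * P) \<in> H" by (rule conjugate[OF A P(2)])
  with P show ?thesis by (simp add: S_def)
qed

lemma S_uminus: "P \<in> S \<Longrightarrow> - P \<in> S"
  using S_scale[of P "-1"] by simp

lemma S_diff: "P \<in> S \<Longrightarrow> Q \<in> S \<Longrightarrow> P - Q \<in> S"
  using S_add[OF _ S_uminus, of P Q] by simp

lemma S_scale_iff: "c \<noteq> 0 \<Longrightarrow> const3 c * P \<in> S \<longleftrightarrow> P \<in> S"
  using S_scale[of P c] S_scale[of "const3 c * P" "inverse c"] const3_inverse(1)[of c P] by metis

lemma S_sum: "(\<And>i. i \<in> A \<Longrightarrow> f i \<in> S) \<Longrightarrow> sum f A \<in> S"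
  by (induction A rule: infinite_finite_induct) (simp_all add: S_0 S_add)

lemma S_swap: "P \<in> S \<Longrightarrow> swap_yz P \<in> S"
  by (rule S_conj) (use swap_Aff Aff in auto)

definition elemY :: "'k poly \<Rightarrow> 'k poly3 \<Rightarrow> 'k poly3" where
  "elemY r = subst varX (varY + zpoly r) varZ"

lemma elemY_vars [simp]: "elemY r varX = varX" "elemY r varY = varY + zpoly r" "elemY r varZ = varZ"
  by (simp_all add: elemY_def)

lemma alg_hom_elemY: "alg_hom (elemY r)"
  by (simp add: elemY_def alg_hom_subst)

lemmas elemY_simps [simp] =
  alg_hom.add [OF alg_hom_elemY] alg_hom.mult [OF alg_hom_elemY] alg_hom.const [OF alg_hom_elemY]
  alg_hom.power [OF alg_hom_elemY]

text \<open>Exchanging \<open>x\<close> and \<open>y\<close> turns shears in \<open>x\<close> into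
  shears in \<open>y\<close>, so \<open>S\<close> controls both kinds. This is limited to shears by
  elements of K[z], which the swap leaves alone.\<close>

lemma elemY_swap: "swap_xy \<circ> elem (zpoly r) = elemY r \<circ> swap_xy"
  "swap_xy \<circ> elemY r = elem (zpoly r) \<circ> swap_xy"
  by (rule alg_hom_eqI;
      simp add: alg_hom_comp alg_hom_elem alg_hom_elemY alg_hom_affine alg_hom.zpoly [OF alg_hom_affine(1)])+

lemma elemY_iff: "elemY r \<in> H \<longleftrightarrow> zpoly r \<in> S"
proof
  have sw: "swap_xy \<in> H" using swap_Aff Aff by auto
  show "zpoly r \<in> S" if "elemY r \<in> H"
    using conjugate[OF sw that elemY_swap(2)] by (simp add: S_def)
  show "elemY r \<in> H" if "zpoly r \<in> S"
    using conjugate[OF sw _ elemY_swap(1)] that by (simp add: S_def)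
qed

lemma S_shift: "zpoly r \<in> S \<Longrightarrow> P \<in> S \<Longrightarrow> elemY r P \<in> S"
  using S_conj[of "elemY r" P] by (simp add: elemY_iff)

end


section \<open>Monomials as eigenvectors of scalings, and the passage to all tame
  automorphisms\<close>

lemma yz_expand:
  fixes p :: "'k::field poly poly"
  shows "[:p:] = (\<Sum>j\<le>degree p. zpoly (coeff p j) * varY ^ j)"
proof -
  have "(varY :: 'k poly3) ^ j = [:[:0, 1:] ^ j:]" for j
    by (induction j) (simp_all add: varY_def one_pCons)
  then have "zpoly (coeff p j) * varY ^ j = [:monom (coeff p j) j:]" for j
    by (simp add: zpoly_def monom_altdef)
  moreover have "(\<Sum>j\<le>n. [:monom (coeff p j) j:]) = [:\<Sum>j\<le>n. monom (coeff p j) j:]" for n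
    by (induction n) simp_all
  ultimately show ?thesis by (simp add: poly_as_sum_of_monoms)
qed

lemma zpoly_expand: "zpoly r = (\<Sum>k\<le>degree r. const3 (coeff r k) * varZ ^ k)"
proof -
  have "const3 (coeff r k) * varZ ^ k = zpoly (monom (coeff r k) k)" for k
    by (simp add: zpoly_const [symmetric] zpoly_Z [symmetric] zpoly_power [symmetric]
        zpoly_simps(6) [symmetric] monom_altdef del: zpoly_simps(6))
  moreover have "(\<Sum>k\<le>n. zpoly (monom (coeff r k) k)) = zpoly (\<Sum>k\<le>n. monom (coeff r k) k)" for n
    by (induction n) simp_all
  ultimately show ?thesis by (simp add: poly_as_sum_of_monoms)
qed

text \<open>Makes the eigenvalues of the scaling by 2 distinct on different powers of a
  variable.\<close>

lemma inj_power_2: "inj (\<lambda>i::nat. (2 :: 'k::field_char_0) ^ i)"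
proof
  fix i j :: nat assume "(2 :: 'k) ^ i = 2 ^ j"
  then have "(of_nat (2 ^ i) :: 'k) = of_nat (2 ^ j)" by simp
  then have "(2::nat) ^ i = 2 ^ j" by (simp only: of_nat_eq_iff)
  then show "i = j" by simp
qed

context overgroup
begin

text \<open>The difference \<open>D P - l j P\<close> kills the component \<open>j\<close> and rescales the others.\<close>

lemma S_eigencomponents:
  assumes "alg_hom D" "\<And>P. P \<in> S \<Longrightarrow> D P \<in> S"
    and "finite I" "inj_on l I" "\<And>i. i \<in> I \<Longrightarrow> D (v i) = const3 (l i) * v i"
    and "(\<Sum>i\<in>I. v i) \<in> S" "i \<in> I"
  shows "v i \<in> S"
  using assms(3-7)
proof (induction I arbitrary: v i rule: finite_induct)
  case empty
  then show ?case by simp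
next
  case (insert j I)
  interpret D: alg_hom D by fact
  let ?s = "\<Sum>i\<in>I. v i"
  have D: "D (v i) = const3 (l i) * v i" if "i \<in> insert j I" for i
    using insert.prems(2) that by blast
  have sum: "v j + ?s \<in> S" using insert by simp
  have "D ?s = (\<Sum>i\<in>I. const3 (l i) * v i)"
    using D by (simp add: D.sum)
  then have "D (v j + ?s) - const3 (l j) * (v j + ?s) = (\<Sum>i\<in>I. const3 (l i - l j) * v i)"
    using D[of j] by (simp add: sum_distrib_left sum_subtractf algebra_simps)
  moreover have "D (v j + ?s) - const3 (l j) * (v j + ?s) \<in> S"
    using assms(2) sum S_diff S_scale by blast
  ultimately have S: "(\<Sum>i\<in>I. const3 (l i - l j) * v i) \<in> S" by simp
  have I: "v i \<in> S" if "i \<in> I" for i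
  proof -
    have "const3 (l i - l j) * v i \<in> S"
    proof (rule insert.IH[where v = "\<lambda>i. const3 (l i - l j) * v i"])
      show "inj_on l I" using insert.prems(1) by (rule inj_on_subset) blast
      show "D (const3 (l i - l j) * v i) = const3 (l i) * (const3 (l i - l j) * v i)"
        if "i \<in> I" for i
        using D[of i] that by (simp only: D.mult D.const insert_iff simp_thms ac_simps)
    qed (use S that in auto)
    moreover have "l i - l j \<noteq> 0"
      using insert.prems(1) insert.hyps(2) that by (auto simp: inj_on_def)
    ultimately show ?thesis by (simp only: S_scale_iff not_False_eq_True)
  qed
  then have "v j \<in> S" using S_diff[OF sum S_sum[of I v]] by simp
  with I insert.prems(4) show ?case by blast
qed

lemma S_diag:
  assumes "b \<noteq> 0" "c \<noteq> 0" "P \<in> S"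
  shows "diag 1 b c 0 P \<in> S"
  using assms diag_Aff[of 1 b c 0] Aff by - (rule S_conj, auto)

text \<open>Two eigenspace decompositions: scaling \<open>y\<close> isolates the part of
  \<open>y\<close>-degree \<open>j\<close>, whose coefficient is still in K[z]; scaling
  \<open>z\<close> then isolates the single monomial.\<close>

lemma S_coeff:
  assumes "P \<in> S" "coeff3 P i j k \<noteq> 0"
  shows "varY ^ j * varZ ^ k \<in> S"
proof -
  interpret D1: alg_hom "diag 1 2 1 (0::'k)" by (rule alg_hom_affine)
  interpret D2: alg_hom "diag 1 1 2 (0::'k)" by (rule alg_hom_affine)
  obtain p where P: "P = [:p:]" using assms(1) by (auto simp: S_def yz_def)
  have c: "coeff (coeff p j) k \<noteq> 0"
    using assms(2) by (auto simp: P coeff3_yz split: if_splits)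
  let ?v = "\<lambda>j. zpoly (coeff p j) * varY ^ j"
  have v: "?v j \<in> S"
  proof (rule S_eigencomponents[where D = "diag 1 2 1 0" and v = ?v and l = "\<lambda>j. 2 ^ j"])
    show "sum ?v {..degree p} \<in> S" using assms(1) by (simp only: P yz_expand)
    show "j \<in> {..degree p}" using c by (auto intro!: le_degree)
    show "diag 1 2 1 0 (?v i) = const3 (2 ^ i) * ?v i" for i
    proof -
      have "const3 b ^ i = const3 (b ^ i)" for b :: 'k by (induction i) simp_all
      then show ?thesis by (simp add: D1.zpoly power_mult_distrib)
    qed
  qed (use inj_power_2 in \<open>auto intro: D1.alg_hom_axioms S_diag inj_on_subset\<close>)
  let ?r = "coeff p j"
  let ?w = "\<lambda>k. const3 (coeff ?r k) * varZ ^ k * varY ^ j"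
  have "?w k \<in> S"
  proof (rule S_eigencomponents[where D = "diag 1 1 2 0" and v = ?w and l = "\<lambda>j. 2 ^ j"])
    show "sum ?w {..degree ?r} \<in> S" using v by (simp only: zpoly_expand sum_distrib_right)
    show "k \<in> {..degree ?r}" using c by (auto intro!: le_degree)
    show "diag 1 1 2 0 (?w i) = const3 (2 ^ i) * ?w i" for i
    proof -
      have "const3 b ^ i = const3 (b ^ i)" for b :: 'k by (induction i) simp_all
      then show ?thesis by (simp add: power_mult_distrib)
    qed
  qed (use inj_power_2 in \<open>auto intro: D2.alg_hom_axioms S_diag inj_on_subset\<close>)
  then show ?thesis using c S_scale_iff[of "coeff ?r k" "varY ^ j * varZ ^ k"] by (simp add: ac_simps)
qed

text \<open>Since \<open>G\<close> and \<open>F\<close> are fixed by the scaling of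
  \<open>y\<close>, the terms of the binomial expansion are eigenvectors with eigenvalues
  \<open>2 ^ k\<close>, and their binomial coefficients can be divided out.\<close>

lemma S_binomial:
  assumes "(varY + G) ^ n * F \<in> S" "diag 1 2 1 0 G = G" "diag 1 2 1 0 F = F" "k \<le> n"
  shows "varY ^ k * G ^ (n - k) * F \<in> S"
proof -
  interpret D: alg_hom "diag 1 2 1 (0::'k)" by (rule alg_hom_affine)
  have of_nat: "(of_nat m :: 'k poly3) = const3 (of_nat m)" for m
    by (induction m) simp_all
  let ?v = "\<lambda>k. const3 (of_nat (n choose k)) * (varY ^ k * G ^ (n - k) * F)"
  have "?v k \<in> S"
  proof (rule S_eigencomponents[where D = "diag 1 2 1 0" and v = ?v and l = "\<lambda>j. 2 ^ j"])
    show "sum ?v {..n} \<in> S"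
      using assms(1) by (simp only: binomial_ring of_nat sum_distrib_right mult.assoc)
    show "diag 1 2 1 0 (?v i) = const3 (2 ^ i) * ?v i" for i
    proof -
      have "const3 b ^ i = const3 (b ^ i)" for b :: 'k by (induction i) simp_all
      then show ?thesis by (simp add: assms(2,3) power_mult_distrib)
    qed
  qed (use inj_power_2 assms in \<open>auto intro: D.alg_hom_axioms S_diag inj_on_subset\<close>)
  moreover have "(of_nat (n choose k) :: 'k) \<noteq> 0" using assms(4) by simp
  ultimately show ?thesis by (simp only: S_scale_iff not_False_eq_True)
qed

lemma S_all:
  assumes "F \<in> S" "\<not> lin F"
  shows "[:p:] \<in> S"
proof -
  interpret swap: alg_hom "swap_yz :: 'k poly3 \<Rightarrow> 'k poly3" by (rule alg_hom_affine)
  interpret D: alg_hom "diag 1 2 1 (0::'k)" by (rule alg_hom_affine)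
  have Z: "zpoly [:0, 1:] \<in> S" by (rule S_lin) (simp_all add: zpoly_Z lin_basic)
  have one: "zpoly 1 \<in> S" by (rule S_lin) (use lin_basic(1)[of 1] yz_const[of 1] in simp_all)
  obtain i j k where ijk: "coeff3 F i j k \<noteq> 0" "i + j + k > 1"
    using assms(2) by (auto simp: lin_def not_le)
  have "i = 0" using S_yz[OF assms(1)] ijk(1) by (auto simp: yz_def coeff3_yz split: if_splits)
  define n where "n = j + k"
  have n: "n \<ge> 2" using ijk(2) \<open>i = 0\<close> by (simp add: n_def)
  have "varY ^ j * varZ ^ k \<in> S" using S_coeff[OF assms(1) ijk(1)] .
  \<comment> \<open>The term of this expansion free of \<open>y\<close> is the pure power of
    \<open>z\<close> with exponent \<open>j + k = n\<close>.\<close>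
  from S_shift[OF Z this] have "(varY + varZ) ^ j * varZ ^ k \<in> S"
    by (simp add: zpoly_Z)
  from S_binomial[OF this, of 0] have "varZ ^ n \<in> S"
    by (simp add: n_def power_add)
  from S_swap[OF this] have "varY ^ n \<in> S" by simp
  \<comment> \<open>A shift by a constant makes lower powers of \<open>y\<close> appear, which
    brings the degree down to 2.\<close>
  from S_shift[OF one this] have "(varY + 1) ^ n * 1 \<in> S" by simp
  from S_binomial[OF this, of 2] n have "varY ^ 2 \<in> S" by simp
  from S_shift[OF Z this] have Y2: "(varY + varZ) ^ 2 * 1 \<in> S" by (simp add: zpoly_Z)
  have YZ: "varY * varZ \<in> S" using S_binomial[OF Y2, of 1] by simp
  have Z2: "varZ ^ 2 \<in> S" using S_binomial[OF Y2, of 0] by simp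
  \<comment> \<open>Induction: once z^(m+2) is in \<open>S\<close>, the shift of \<open>y\<close> by
    it changes yz by z^(m+3). The exponents 0 and 1 are affine.\<close>
  have "varZ ^ (m + 2) \<in> S" for m
  proof (induction m)
    case 0
    then show ?case using Z2 by (simp only: add_0)
  next
    case (Suc m)
    then have "zpoly ([:0, 1:] ^ (m + 2)) \<in> S" by (simp only: zpoly_power zpoly_Z)
    from S_diff[OF S_shift[OF this YZ] YZ] have "(varY + varZ ^ (m + 2)) * varZ - varY * varZ \<in> S"
      by (simp only: elemY_simps elemY_vars zpoly_power zpoly_Z)
    then show ?case by (simp add: algebra_simps)
  qed
  then have Zm: "varZ ^ m \<in> S" for m
    using Z one by (cases m; cases "m - 1") (auto simp: zpoly_Z numeral_2_eq_2)
  \<comment> \<open>Every monomial occurs in the expansion of a power of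
    \<open>y + z\<close>.\<close>
  have mono: "varZ ^ j * varY ^ k \<in> S" for j k
  proof -
    have "varY ^ (j + k) \<in> S" using S_swap[OF Zm[of "j + k"]] by simp
    from S_shift[OF Z this] have "(varY + varZ) ^ (j + k) * 1 \<in> S" by (simp add: zpoly_Z)
    from S_binomial[OF this, of k] show ?thesis by (simp add: mult.commute)
  qed
  have "zpoly r * varY ^ k \<in> S" for r k
    by (simp only: zpoly_expand sum_distrib_right mult.assoc) (intro S_sum S_scale mono)
  then show ?thesis
    by (simp only: yz_expand) (rule S_sum)
qed

text \<open>Splits a triangular automorphism into a shear in \<open>x\<close>, a shear in
  \<open>y\<close> and an affine factor, so that membership in \<open>H\<close> depends on the two
  shears only.\<close>

lemma triangular_factor:
  assumes "alg_hom \<rho>" "a \<noteq> 0" "b \<noteq> 0" "c \<noteq> 0"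
    and "\<rho> varX = const3 a * varX + [:p:]" "\<rho> varY = const3 b * varY + zpoly q"
    and "\<rho> varZ = const3 c * varZ + const3 r"
  shows "\<rho> = elem (const3 (inverse a) * [:p:]) \<circ> elemY (smult (inverse b) q) \<circ> diag a b c r"
    and "diag a b c r \<in> H"
proof -
  have s: "zpoly (smult (inverse b) q) = const3 (inverse b) * zpoly q"
    by (simp add: zpoly_def const3_def)
  show "\<rho> = elem (const3 (inverse a) * [:p:]) \<circ> elemY (smult (inverse b) q) \<circ> diag a b c r"
    by (rule alg_hom_eqI)
      (simp_all add: assms s alg_hom_comp alg_hom_elem alg_hom_elemY alg_hom_affine distrib_left del: mult_pCons_left mult_pCons_right)
  show "diag a b c r \<in> H" using diag_Aff Aff assms by blast
qed

lemma TA3_subset: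
  assumes "F \<in> S" "\<not> lin F"
  shows "TA3 \<subseteq> H"
proof -
  have "\<rho> \<in> H" if BA: "\<rho> \<in> BA3" for \<rho> :: "'k poly3 \<Rightarrow> 'k poly3"
  proof -
    have hom: "alg_hom \<rho>" using BA by (simp add: BA3_def GA3_def is_algebra_aut_iff)
    obtain a p b q c r where \<rho>: "a \<noteq> 0" "b \<noteq> 0" "c \<noteq> 0"
      "\<rho> varX = const3 a * varX + [:p:]" "\<rho> varY = const3 b * varY + zpoly q"
      "\<rho> varZ = const3 c * varZ + const3 r"
      using BA unfolding BA3_def zpoly_def by blast
    have "elem (const3 (inverse a) * [:p:]) \<in> H"
      using S_scale[OF S_all[OF assms]] by (simp only: S_def mem_Collect_eq)
    moreover have "elemY (smult (inverse b) q) \<in> H"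
      unfolding elemY_iff using S_all[OF assms] by (simp only: zpoly_def)
    ultimately show ?thesis
      using triangular_factor[OF hom \<rho>] comp by metis
  qed
  then show ?thesis
    unfolding TA3_def using Aff by (intro group.generate_subgroup_incl[OF group_GA3]) (auto simp: subgroup)
qed

text \<open>Conjugation by \<open>x \<mapsto> 2x\<close> commutes with the \<open>y\<close>-part of a triangular automorphism but
  rescales its \<open>x\<close>-part, which separates the two.\<close>

lemma triangular_parts:
  assumes "\<rho> \<in> H" "a \<noteq> 0" "b \<noteq> 0"
    and "\<rho> varX = const3 a * varX + P" "yz P"
    and "\<rho> varY = const3 b * varY + zpoly q" "\<rho> varZ = varZ"
  shows "P \<in> S" "zpoly q \<in> S"
proof -
  obtain p where p: "P = [:p:]" using assms(5) by (auto simp: yz_def)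
  define E where "E = const3 (inverse a) * P"
  define s where "s = smult (inverse b) q"
  have yzE: "yz E" "yz (const3 (1/2) * E)" using assms(5) by (auto simp: E_def)
  have s: "zpoly s = const3 (inverse b) * zpoly q"
    by (simp add: zpoly_def const3_def s_def)
  have "\<rho> varX = const3 a * varX + [:p:]" "\<rho> varZ = const3 1 * varZ + const3 0"
    using assms p by simp_all
  note f = triangular_factor[OF hom[OF assms(1)] assms(2,3) one_neq_zero this(1) assms(6) this(2),
      folded p, folded E_def s_def]
  from f assms(1) have H: "elem E \<circ> elemY s \<in> H" by (metis cancel_right)
  let ?L = "diag 2 1 1 0"
  have L: "?L \<in> H" using diag_Aff[of "2::'k" 1 1 0] Aff by auto
  have LE: "?L E = E" by (rule alg_hom.yz_fixed) (simp_all add: alg_hom_affine yzE)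
  have "?L \<circ> (elem E \<circ> elemY s) = (elem (const3 (1/2) * E) \<circ> elemY s) \<circ> ?L"
  proof (rule alg_hom_eqI)
    have "const3 2 * (const3 (1/2) * E) = E"
      by (simp add: mult.assoc [symmetric] const3_simps(6) [symmetric] del: const3_simps(6))
    then show "(?L \<circ> (elem E \<circ> elemY s)) varX = (elem (const3 (1/2) * E) \<circ> elemY s \<circ> ?L) varX"
      by (simp add: LE distrib_left)
  qed (simp_all add: yzE alg_hom_comp alg_hom_elem alg_hom_elemY alg_hom_affine
        alg_hom.zpoly [OF alg_hom_affine(3)])
  from conjugate[OF L H this] have "elem (const3 (1/2) * E) \<circ> elemY s \<in> H" .
  \<comment> \<open>In the quotient of the element and its conjugate the shears in \<open>y\<close>
    cancel, which leaves the shear in \<open>x\<close> by \<open>E/2\<close>.\<close>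
  moreover have "elem E \<circ> elemY s = elem (E - const3 (1/2) * E) \<circ> (elem (const3 (1/2) * E) \<circ> elemY s)"
    using yzE by (simp add: comp_assoc [symmetric] elem_comp)
  ultimately have "elem (E - const3 (1/2) * E) \<in> H" using H cancel_right by metis
  moreover have "E - const3 (1/2) * E = const3 (1/2) * E"
  proof -
    have "E - const3 (1/2) * E = const3 (1 - 1/2) * E" by (simp only: const3_simps left_diff_distrib mult_1)
    then show ?thesis by simp
  qed
  ultimately have "const3 (1/2) * E \<in> S" using yzE by (simp add: S_def)
  then have "E \<in> S" using S_scale_iff[of "1/2" E] by simp
  then show "P \<in> S" using S_scale_iff[of "inverse a" P] assms(2) by (simp add: E_def)
  have "elemY s \<in> H" using \<open>E \<in> S\<close> cancel_left[OF H] by (simp add: S_def)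
  then show "zpoly q \<in> S" using S_scale_iff[of "inverse b" "zpoly q"] assms(3) by (simp add: elemY_iff s)
qed

end


section \<open>Polynomials in one coordinate\<close>

text \<open>Here \<open>'k poly poly\<close> is read as K[z][T] with a new variable T, and T is
  replaced by \<open>G\<close>.\<close>

definition evz :: "'k::field poly poly \<Rightarrow> 'k poly3 \<Rightarrow> 'k poly3" where
  "evz W G = poly (map_poly zpoly W) G"

lemma evz_pCons [simp]: "evz 0 G = 0" "evz (pCons a W) G = zpoly a + G * evz W G"
  by (simp_all add: evz_def map_poly_pCons)

lemma evz_add: "evz (V + W) G = evz V G + evz W G"
  unfolding evz_def by (rule poly_map_poly_add) simp_all

lemma evz_smult: "evz (smult a W) G = zpoly a * evz W G"
  by (induction W) (simp_all add: algebra_simps)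

lemma evz_diff: "evz (V - W) G = evz V G - evz W G"
  using evz_add[of "V - W" W G] by (simp add: algebra_simps)

lemma evz_mult: "evz (V * W) G = evz V G * evz W G"
  by (induction V) (simp_all add: evz_add evz_smult algebra_simps)

lemma evz_shift: "evz (pcompose W [:a, 1:]) G = evz W (zpoly a + G)"
  by (induction W) (simp_all add: pcompose_pCons evz_add evz_mult evz_smult algebra_simps)

text \<open>Turns an element of K[y,z] into an \<open>evz\<close> term, so that its image under a
  homomorphism fixing \<open>z\<close> can be written through the image of \<open>y\<close>.\<close>

lemma evz_Y: "evz p varY = [:p:]"
  by (induction p) (simp_all add: zpoly_def varY_def)

lemma (in alg_hom) evz: "\<phi> varZ = varZ \<Longrightarrow> \<phi> (evz W G) = evz W (\<phi> G)"
  by (induction W) (simp_all add: zpoly)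

text \<open>The term of degree \<open>k + 1\<close> contributes \<open>(k + 1) a\<close> times its
  coefficient in degree \<open>k\<close>; all lower terms stay below degree \<open>k\<close>. Since
  only a degree bound is assumed, the top coefficient may vanish.\<close>

lemma shift_diff:
  fixes W :: "'a::comm_ring_1 poly"
  assumes "degree W \<le> Suc k"
  shows "degree (pcompose W [:a, 1:] - W) \<le> k"
    and "coeff (pcompose W [:a, 1:] - W) k = of_nat (Suc k) * a * coeff W (Suc k)"
proof -
  have "degree (pcompose W [:a, 1:] - W) \<le> k \<and>
      coeff (pcompose W [:a, 1:] - W) k = of_nat (Suc k) * a * coeff W (Suc k)"
    using assms
  proof (induction W arbitrary: k)
    case 0
    then show ?case by simp
  next
    case (pCons w W)
    let ?D = "pcompose W [:a, 1:] - W"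
    \<comment> \<open>This is (T+a) W(T+a) - T W(T), rewritten with the difference for
      \<open>W\<close>; the constant term \<open>w\<close> cancels.\<close>
    have D: "pcompose (pCons w W) [:a, 1:] - pCons w W
        = pCons 0 ?D + smult a ?D + smult a W"
      by (simp add: pcompose_pCons algebra_simps smult_diff_right)
    have W: "degree W \<le> k" using pCons.prems pCons.hyps by (auto split: if_splits)
    show ?case
    proof (cases k)
      case 0
      then obtain w' where "W = [:w':]" using W by (auto elim: degree_eq_zeroE)
      with 0 show ?thesis by (simp add: pcompose_pCons)
    next
      case (Suc l)
      with W pCons.IH[of l] have IH: "degree ?D \<le> l" "coeff ?D l = of_nat (Suc l) * a * coeff W (Suc l)"
        by simp_all
      have "degree (pCons 0 ?D) \<le> k" using IH(1) Suc by (auto intro: order.trans[OF degree_pCons_le])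
      moreover have "degree (smult a ?D) \<le> k" "degree (smult a W) \<le> k"
        using IH(1) W Suc by (meson degree_smult_le le_SucI order.trans)+
      ultimately have "degree (pCons 0 ?D + smult a ?D + smult a W) \<le> k"
        by (intro degree_add_le)
      moreover have "coeff ?D k = 0" using IH(1) Suc by (intro coeff_eq_0) simp
      ultimately show ?thesis using IH(2) Suc by (simp add: D algebra_simps)
    qed
  qed
  then show "degree (pcompose W [:a, 1:] - W) \<le> k"
    "coeff (pcompose W [:a, 1:] - W) k = of_nat (Suc k) * a * coeff W (Suc k)" by auto
qed

section \<open>Polynomials in \<open>G\<close> over K[y,z], up to denominators from K[z]\<close>

locale denominators =
  fixes M :: "'k::field poly set"
  assumes one: "1 \<in> M" and mult: "r \<in> M \<Longrightarrow> s \<in> M \<Longrightarrow> r * s \<in> M" and nonzero: "0 \<notin> M"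
begin

text \<open>The intersection of K[x,y,z] with M^(-1) K[y,z][G]. The choice of \<open>M\<close>
  decides what is learned from \<open>loc_X\<close>: units give a unit coefficient of
  \<open>x\<close>, all nonzero polynomials amount to working over K(z).\<close>

definition loc :: "'k poly3 \<Rightarrow> 'k poly3 set" where
  "loc G = {F. \<exists>r\<in>M. \<exists>A. zpoly r * F = pcompose A G}"

lemma locI: "r \<in> M \<Longrightarrow> zpoly r * F = pcompose A G \<Longrightarrow> F \<in> loc G"
  by (auto simp: loc_def)

lemma locE:
  assumes "F \<in> loc G"
  obtains r A where "r \<in> M" "zpoly r * F = pcompose A G"
  using assms by (auto simp: loc_def)

lemma loc_yz: "yz F \<Longrightarrow> F \<in> loc G"
  by (rule locI[OF one, where A = F]) (auto simp: yz_def)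

lemma loc_self: "G \<in> loc G"
  by (rule locI[OF one, where A = varX]) (simp add: varX_def pcompose_pCons)

lemma pcompose_zpoly: "pcompose (zpoly r) G = zpoly r"
  by (simp add: zpoly_def)

lemma loc_add: "F1 \<in> loc G \<Longrightarrow> F2 \<in> loc G \<Longrightarrow> F1 + F2 \<in> loc G"
proof (elim locE)
  fix r1 A1 r2 A2
  assume r: "r1 \<in> M" "r2 \<in> M" "zpoly r1 * F1 = pcompose A1 G" "zpoly r2 * F2 = pcompose A2 G"
  have "zpoly (r1 * r2) * (F1 + F2) = zpoly r2 * (zpoly r1 * F1) + zpoly r1 * (zpoly r2 * F2)"
    by (simp add: algebra_simps)
  also have "\<dots> = pcompose (zpoly r2 * A1 + zpoly r1 * A2) G"
    by (simp only: r pcompose_add pcompose_mult pcompose_zpoly)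
  finally show ?thesis using r mult locI by blast
qed

lemma loc_mult: "F1 \<in> loc G \<Longrightarrow> F2 \<in> loc G \<Longrightarrow> F1 * F2 \<in> loc G"
proof (elim locE)
  fix r1 A1 r2 A2
  assume r: "r1 \<in> M" "r2 \<in> M" "zpoly r1 * F1 = pcompose A1 G" "zpoly r2 * F2 = pcompose A2 G"
  have "zpoly (r1 * r2) * (F1 * F2) = (zpoly r1 * F1) * (zpoly r2 * F2)"
    by (simp add: algebra_simps)
  also have "\<dots> = pcompose (A1 * A2) G"
    by (simp only: r pcompose_mult)
  finally show ?thesis using r mult locI by blast
qed

lemma loc_diff: "F1 \<in> loc G \<Longrightarrow> F2 \<in> loc G \<Longrightarrow> F1 - F2 \<in> loc G"
  using loc_add[of F1 G "const3 (-1) * F2"] loc_mult[OF loc_yz[OF yz_const[of "-1"]], of F2] by simp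

lemma loc_cancel:
  assumes "r \<in> M" "zpoly r * F \<in> loc G"
  shows "F \<in> loc G"
proof -
  obtain s A where "s \<in> M" "zpoly s * (zpoly r * F) = pcompose A G"
    using assms(2) by (elim locE)
  then have "s * r \<in> M" "zpoly (s * r) * F = pcompose A G"
    using assms(1) by (simp_all add: mult mult.assoc)
  then show ?thesis by (rule locI)
qed

lemma loc_evz: "F \<in> loc G \<Longrightarrow> evz W F \<in> loc G"
  by (induction W) (simp_all add: loc_yz loc_add loc_mult)

lemma loc_image:
  assumes "alg_hom \<phi>" "\<phi> varX \<in> loc G" "\<phi> varY \<in> loc G" "\<phi> varZ \<in> loc G"
  shows "\<phi> F \<in> loc G"
proof -
  interpret alg_hom \<phi> by fact
  show ?thesis
    by (induction F rule: poly3_induct) (simp_all add: assms loc_add loc_mult loc_yz)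
qed

text \<open>Degrees in \<open>x\<close> multiply under composition, so \<open>r x = A(G)\<close> forces \<open>G\<close> to have degree 1.\<close>

lemma loc_X:
  assumes "varX \<in> loc G"
  obtains r c q where "r \<in> M" "c dvd r" "c \<noteq> 0" "G = zpoly c * varX + [:q:]"
proof -
  obtain r A where r: "r \<in> M" "zpoly r * varX = pcompose A G" using assms by (elim locE)
  then have "r \<noteq> 0" using nonzero by auto
  have rX: "zpoly r * varX = [:0, [:r:]:]" by (simp add: zpoly_def varX_def)
  have "degree (pcompose A G) = 1"
    using \<open>r \<noteq> 0\<close> by (simp add: r(2) [symmetric] rX)
  then have "degree A * degree G = 1" by (simp only: degree_pcompose)
  then have deg: "degree A = 1" "degree G = 1" by simp_all
  obtain a0 a1 g0 g1 where AG: "A = [:a0, a1:]" "G = [:g0, g1:]"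
    using deg by (metis One_nat_def degree1_coeffs)
  \<comment> \<open>Coefficients of \<open>x\<close> are compared. As \<open>r\<close> has degree 0
    in \<open>y\<close>, so do both factors.\<close>
  then have "g1 * a1 = [:r:]" using r(2) by (simp add: rX pcompose_pCons)
  moreover from this have "degree g1 + degree a1 = 0"
    using \<open>r \<noteq> 0\<close> by (subst degree_mult_eq [symmetric]) auto
  ultimately obtain c a where "g1 = [:c:]" "a1 = [:a:]" "c * a = r"
    by (auto elim!: degree_eq_zeroE)
  then show ?thesis using that[of r c g0] r(1) \<open>r \<noteq> 0\<close> AG by (auto simp: zpoly_def varX_def)
qed

end

section \<open>Clearing denominators\<close>

lemma common_denominator:
  fixes P :: "'a::idom fract poly"
  obtains m P' where "m \<noteq> 0" "smult (to_fract m) P = map_poly to_fract P'"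
proof -
  have "\<exists>m P'. m \<noteq> 0 \<and> smult (to_fract m) P = map_poly to_fract P'"
  proof (induction P)
    case 0
    show ?case by (intro exI[of _ 1] exI[of _ 0]) simp
  next
    case (pCons a P)
    then obtain m P' where m: "m \<noteq> 0" "smult (to_fract m) P = map_poly to_fract P'" by blast
    obtain u v where a: "a = Fract u v" "v \<noteq> 0" by (cases a)
    then have v: "to_fract v * a = to_fract u" by (simp add: to_fract_def eq_fract)
    have "smult (to_fract (m * v)) (pCons a P) = pCons (to_fract m * (to_fract v * a)) (smult (to_fract v) (smult (to_fract m) P))"
      by (simp add: mult_ac)
    also have "\<dots> = map_poly to_fract (pCons (m * u) (smult v P'))"
      by (simp add: v m(2) map_poly_pCons map_poly_smult)
    finally show ?case using m(1) a(2) by (metis mult_eq_0_iff)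
  qed
  then show ?thesis using that by blast
qed

lemma map_poly_add_hom:
  assumes "f 0 = 0" "\<And>a b. f (a + b) = f a + f b"
  shows "map_poly f (p + q) = map_poly f p + map_poly f q"
  by (rule poly_eqI) (simp add: coeff_map_poly assms)

lemma map_poly_mult_hom:
  fixes f :: "'a::comm_semiring_0 \<Rightarrow> 'b::comm_semiring_0"
  assumes "f 0 = 0" "\<And>a b. f (a + b) = f a + f b" "\<And>a b. f (a * b) = f a * f b"
  shows "map_poly f (p * q) = map_poly f p * map_poly f q"
proof -
  have "f (sum h A) = (\<Sum>i\<in>A. f (h i))" for h :: "nat \<Rightarrow> 'a" and A
    by (induction A rule: infinite_finite_induct) (simp_all add: assms)
  then show ?thesis by (intro poly_eqI) (simp add: coeff_map_poly coeff_mult assms)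
qed

text \<open>The identity defining \<open>R2\<close> lives over K(z). After multiplication by
  denominators it is checked under the injective map \<iota> from K[z][y][x] into
  K(z)[y][x].\<close>

lemma R2_cleared:
  assumes "F \<in> R2"
  obtains m n p q Q where "m \<noteq> 0" "p \<noteq> 0" "n \<noteq> 0"
    "zpoly m * F = zpoly n * varY + evz Q (zpoly p * varX + [:q:])"
proof -
  define \<iota> :: "'a poly3 \<Rightarrow> 'a poly fract poly poly" where "\<iota> = map_poly (map_poly to_fract)"
  define zf :: "'a poly fract \<Rightarrow> 'a poly fract poly poly" where "zf c = [:[:c:]:]" for c
  have map_add: "map_poly to_fract (p + q) = map_poly to_fract p + map_poly to_fract q"
    and map_mult: "map_poly to_fract (p * q) = map_poly to_fract p * map_poly to_fract q"
    for p q :: "'a poly poly"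
    by (rule map_poly_add_hom map_poly_mult_hom; simp)+
  have \<iota>_add: "\<iota> (F + G) = \<iota> F + \<iota> G" and \<iota>_mult: "\<iota> (F * G) = \<iota> F * \<iota> G" for F G
    unfolding \<iota>_def by (rule map_poly_add_hom map_poly_mult_hom; simp add: map_add map_mult)+
  have \<iota>_z: "\<iota> (zpoly r) = zf (to_fract r)" for r
    by (simp add: \<iota>_def zf_def zpoly_def map_poly_pCons)
  have \<iota>_inj: "F = G" if "\<iota> F = \<iota> G" for F G
  proof -
    have "coeff (coeff (\<iota> F) i) j = to_fract (coeff (coeff F i) j)" for F i j
      by (simp add: \<iota>_def coeff_map_poly)
    then have "coeff (coeff F i) j = coeff (coeff G i) j" for i j
      using that by (metis to_fract_eq_iff)
    then show ?thesis by (simp add: poly_eq_iff)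
  qed
  obtain p1 p2 Q1 Q2 where F: "p1 \<noteq> 0" "p2 \<noteq> 0"
    "\<iota> F = [:[:0, p2:]:] + poly (map_poly zf Q2) [:Q1, [:p1:]:]"
    using assms unfolding R2_def \<iota>_def zf_def by blast
  obtain s1 q' where s1: "s1 \<noteq> 0" "smult (to_fract s1) Q1 = map_poly to_fract q'"
    by (rule common_denominator)
  have fract: "\<exists>u v. v \<noteq> 0 \<and> to_fract v * c = to_fract u" for c :: "'a poly fract"
  proof -
    obtain u v where "c = Fract u v" "v \<noteq> 0" by (cases c)
    then have "v \<noteq> 0 \<and> to_fract v * c = to_fract u" by (simp add: to_fract_def eq_fract)
    then show ?thesis by blast
  qed
  obtain u v where p1: "v \<noteq> 0" "to_fract v * p1 = to_fract u" using fract by blast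
  obtain u2 v2 where p2: "v2 \<noteq> 0" "to_fract v2 * p2 = to_fract u2" using fract by blast
  \<comment> \<open>\<open>s\<close> clears both denominators of the inner polynomial: s (p1 x + Q1)
    = p x + q with \<open>p\<close>, \<open>q\<close> over K[z].\<close>
  define s where "s = s1 * v"
  define p where "p = s1 * u"
  define q where "q = smult v q'"
  let ?g = "zpoly p * varX + [:q:]" and ?h = "[:Q1, [:p1:]:]"
  have "s \<noteq> 0" using s1 p1 by (simp add: s_def)
  have "map_poly to_fract q = smult (to_fract v) (smult (to_fract s1) Q1)"
    by (simp add: q_def s1(2))
  moreover have "to_fract p = to_fract s1 * (to_fract v * p1)" by (simp add: p_def p1(2))
  moreover have "?g = [:q, [:p:]:]" by (simp add: zpoly_def varX_def)
  ultimately have g: "\<iota> ?g = zf (to_fract s) * ?h"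
    by (simp add: \<iota>_def zf_def s_def map_poly_pCons mult_ac)
  have "u \<noteq> 0" "u2 \<noteq> 0" using p1 p2 F(1,2) by auto
  \<comment> \<open>P(T) = Q2(T/s) compensates for the factor \<open>s\<close> put into the
    argument.\<close>
  define P where "P = pcompose Q2 [:0, inverse (to_fract s):]"
  obtain m Q' where m: "m \<noteq> 0" "smult (to_fract m) P = map_poly to_fract Q'"
    by (rule common_denominator)
  have zf: "zf 0 = 0" "zf (a + b) = zf a + zf b" "zf (a * b) = zf a * zf b" for a b
    by (simp_all add: zf_def)
  \<comment> \<open>The counterpart of \<open>evz\<close> over K(z); \<open>\<iota>_evz\<close>
    below relates the two.\<close>
  define ev where "ev R G = poly (map_poly zf R) G" for R G
  have ev: "ev 0 G = 0" "ev (pCons a R) G = zf a + G * ev R G"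
    "ev (R + R') G = ev R G + ev R' G" "ev (R * R') G = ev R G * ev R' G" for a R R' G
    by (simp_all add: ev_def map_poly_pCons zf poly_map_poly_add poly_map_poly_mult)
  have ev_smult: "ev (smult a R) G = zf a * ev R G" for a R G
    by (induction R) (simp_all add: ev zf algebra_simps)
  have ev_scale: "ev (pcompose R [:0, c:]) G = ev R (zf c * G)" for R c G
    by (induction R) (simp_all add: ev ev_smult zf pcompose_pCons algebra_simps)
  have \<iota>_evz: "\<iota> (evz R G) = ev (map_poly to_fract R) (\<iota> G)" for R G
  proof (induction R)
    case 0
    show ?case by (simp add: ev \<iota>_def)
  next
    case (pCons a R)
    then show ?case by (simp add: ev \<iota>_add \<iota>_mult \<iota>_z map_poly_pCons)
  qed
  have "\<iota> (evz (smult v2 Q') ?g) = zf (to_fract v2) * (zf (to_fract m) * ev P (zf (to_fract s) * ?h))"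
    by (simp only: \<iota>_evz g fract_poly_smult m(2) [symmetric] ev_smult)
  also have "ev P (zf (to_fract s) * ?h) = ev Q2 (zf (inverse (to_fract s) * to_fract s) * ?h)"
    by (simp only: P_def ev_scale zf mult.assoc)
  also have "\<dots> = ev Q2 ?h" using \<open>s \<noteq> 0\<close> by (simp add: zf_def)
  finally have "\<iota> (evz (smult v2 Q') ?g) = zf (to_fract (m * v2)) * ev Q2 ?h"
    by (simp add: zf mult_ac)
  moreover have "\<iota> (zpoly (m * u2) * varY) = zf (to_fract (m * v2)) * [:[:0, p2:]:]"
  proof -
    have "zpoly (m * u2) * varY = [:[:0, m * u2:]:]" by (simp add: zpoly_def varY_def)
    moreover have "to_fract m * to_fract u2 = to_fract m * (to_fract v2 * p2)" by (simp only: p2(2))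
    ultimately show ?thesis by (simp add: \<iota>_def zf_def map_poly_pCons mult_ac)
  qed
  ultimately have "\<iota> (zpoly (m * v2) * F) = \<iota> (zpoly (m * u2) * varY + evz (smult v2 Q') ?g)"
    by (simp only: \<iota>_add \<iota>_mult [of "zpoly (m * v2)"] \<iota>_z F(3) ev_def distrib_left)
  then have "zpoly (m * v2) * F = zpoly (m * u2) * varY + evz (smult v2 Q') ?g"
    by (rule \<iota>_inj)
  moreover have "m * v2 \<noteq> 0" "p \<noteq> 0" "m * u2 \<noteq> 0"
    using \<open>u \<noteq> 0\<close> \<open>u2 \<noteq> 0\<close> s1 p2 m by (simp_all add: p_def)
  ultimately show ?thesis using that by blast
qed


section \<open>Automorphisms fixing \<open>z\<close>\<close>

lemma zpoly_is_unit: "r dvd 1 \<Longrightarrow> \<exists>a. a \<noteq> 0 \<and> zpoly r = const3 a"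
  by (auto simp: is_unit_poly_iff zpoly_const dvd_field_iff)

text \<open>Serves as a divisibility test: a quotient that exists in K[x,y,z] already exists in
  K[z].\<close>

lemma zpoly_coeff: "zpoly r * F = zpoly s \<Longrightarrow> r * coeff (coeff F 0) 0 = s"
  by (drule arg_cong[where f = "\<lambda>F. coeff (coeff F 0) 0"]) (simp add: zpoly_def)

lemma not_lin_zpoly: "degree r \<ge> 2 \<Longrightarrow> \<not> lin (zpoly r)"
proof
  assume r: "degree r \<ge> 2" and l: "lin (zpoly r)"
  have "coeff3 (zpoly r) 0 0 (degree r) \<noteq> 0" using r by (auto simp: coeff3_zpoly)
  with l have "0 + 0 + degree r \<le> 1" unfolding lin_def by blast
  with r show False by simp
qed

locale z_aut = overgroup H for H :: "('k::field_char_0 poly3 \<Rightarrow> 'k poly3) set" +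
  fixes \<sigma> :: "'k poly3 \<Rightarrow> 'k poly3"
  assumes in_H: "\<sigma> \<in> H" and not_Aff: "\<sigma> \<notin> Aff3" and Z: "\<sigma> varZ = varZ"
begin

definition \<tau> :: "'k poly3 \<Rightarrow> 'k poly3" where
  "\<tau> = inv_into UNIV \<sigma>"

sublocale \<sigma>: alg_hom \<sigma>
  using hom[OF in_H] .

lemma \<tau>_H: "\<tau> \<in> H"
  unfolding \<tau>_def by (rule inv_closed[OF in_H])

sublocale \<tau>: alg_hom \<tau>
  using hom[OF \<tau>_H] .

lemma \<tau>_\<sigma> [simp]: "\<tau> (\<sigma> F) = F" and \<sigma>_\<tau> [simp]: "\<sigma> (\<tau> F) = F"
  using inv_comp[OF in_H] by (simp_all add: \<tau>_def fun_eq_iff)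

lemma \<tau>_Z: "\<tau> varZ = varZ"
  using \<tau>_\<sigma>[of varZ] by (simp add: Z)

lemma not_lin: "\<not> (lin (\<sigma> varX) \<and> lin (\<sigma> varY))"
  using Aff3I[OF aut[OF in_H]] not_Aff lin_basic by (auto simp: Z)

text \<open>In the coordinates \<tau>(x), \<tau>(y), z this is the translation of the first one by
  \<open>u\<close>. For \<open>u\<close> of degree at most 1 that translation is affine, which puts
  \<open>\<psi> u\<close> into \<open>H\<close>.\<close>

definition \<psi> :: "'k poly \<Rightarrow> 'k poly3 \<Rightarrow> 'k poly3" where
  "\<psi> u = \<tau> \<circ> elem (zpoly u) \<circ> \<sigma>"

lemma zpoly_S: "degree u \<le> 1 \<Longrightarrow> zpoly u \<in> S"
proof (rule S_lin)
  assume u: "degree u \<le> 1"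
  show "lin (zpoly u)"
    unfolding lin_def using u by (auto simp: coeff3_zpoly dest!: le_degree split: if_splits)
qed simp

lemma \<psi>_H: "degree u \<le> 1 \<Longrightarrow> \<psi> u \<in> H"
  unfolding \<psi>_def using zpoly_S[of u] by (intro comp in_H \<tau>_H) (simp add: S_def)

lemma \<psi>_\<tau>: "\<psi> u (\<tau> F) = \<tau> (elem (zpoly u) F)"
  by (simp add: \<psi>_def)

lemma \<psi>_Z: "\<psi> u varZ = varZ"
  by (simp add: \<psi>_def Z \<tau>_Z)

text \<open>In this case \<sigma> is itself triangular; being non-affine, it has a nonlinear
  component in \<open>S\<close>.\<close>

lemma degree_0_case:
  assumes F: "zpoly m * \<sigma> varY = zpoly n * varY + zpoly r" and m: "m \<noteq> 0"
  shows "TA3 \<subseteq> H"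
proof -
  have "yz (\<sigma> varY)"
    by (rule yz_mult_cancel[of "zpoly m"]) (use m in \<open>simp_all add: F\<close>)
  then obtain f where f: "\<sigma> varY = [:f:]" by (auto simp: yz_def)
  have "zpoly m * [:f:] = zpoly n * varY + zpoly r"
    using F by (simp only: f)
  then have "[:m:] * f = [:r, n:]"
    by (simp add: zpoly_def varY_def)
  moreover have "degree ([:m:] * f) = degree f"
    using m by (cases "f = 0") simp_all
  ultimately have "degree f \<le> 1" by (metis degree_pCons_eq_if degree_pCons_0 One_nat_def le_refl zero_le_one)
  then obtain f0 f1 where f01: "f = [:f0, f1:]"
    by (metis One_nat_def degree1_coeffs degree_eq_zeroE le_Suc_eq le_zero_eq pCons_0_0)
  then have \<sigma>Y: "\<sigma> varY = zpoly f1 * varY + zpoly f0"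
    using f by (simp add: zpoly_def varY_def)
  \<comment> \<open>Applying \<tau> and comparing the coefficients of \<open>y\<close> shows that
    \<open>f1\<close> is a unit.\<close>
  then have "varY = zpoly f1 * \<tau> varY + zpoly f0"
    using \<tau>_\<sigma>[of varY] by (simp only: \<tau>.add \<tau>.mult \<tau>.zpoly[OF \<tau>_Z])
  then have "coeff (coeff varY 0) 1 = coeff (coeff (zpoly f1 * \<tau> varY + zpoly f0) 0) 1"
    by (rule arg_cong)
  then have "f1 * coeff (coeff (\<tau> varY) 0) 1 = 1"
    by (simp add: varY_def zpoly_def)
  then have "f1 dvd 1" by (metis dvd_triv_left)
  then obtain b where b: "b \<noteq> 0" "zpoly f1 = const3 b" using zpoly_is_unit by blast
  \<comment> \<open>No denominators occur: x = \<sigma>(\<tau>(x)) is a polynomial in \<sigma>(x)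
    over K[y,z], so \<open>loc_X\<close> yields a unit coefficient of \<open>x\<close>.\<close>
  interpret D: denominators "{1 :: 'k poly}" by standard simp_all
  have "\<sigma> (\<tau> varX) \<in> D.loc (\<sigma> varX)"
    by (rule D.loc_image) (simp_all add: \<sigma>.alg_hom_axioms D.loc_self D.loc_yz f Z)
  then obtain c q where c: "c dvd 1" "\<sigma> varX = zpoly c * varX + [:q:]"
    using D.loc_X[of "\<sigma> varX"] by (metis \<sigma>_\<tau> singletonD)
  then obtain a where a: "a \<noteq> 0" "zpoly c = const3 a" using zpoly_is_unit by blast
  note parts = triangular_parts[OF in_H a(1) b(1) c(2)[unfolded a(2)] yz_pCons \<sigma>Y[unfolded b(2)] Z]
  have "\<not> (lin [:q:] \<and> lin (zpoly f0))"
    using not_lin by (auto simp: c a \<sigma>Y b intro!: lin_intros)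
  then show ?thesis using parts TA3_subset by blast
qed

text \<open>Applying \<tau> to the hypothesis gives y = b \<tau>(x) + f(\<tau>(y)), which is solved
  for \<tau>(x). Hence x = \<tau>(\<sigma>(x)) is a polynomial in \<tau>(y) up to denominators, and
  \<open>loc_X\<close> applies.\<close>

lemma degree_1_inverse:
  assumes F: "\<sigma> varY = zpoly b * varX + [:f:]" and M: "denominators M" "b \<in> M"
  obtains r c q where "r \<in> M" "c dvd r" "c \<noteq> 0" "\<tau> varY = zpoly c * varX + [:q:]"
proof -
  interpret D: denominators M by fact
  have "varY = zpoly b * \<tau> varX + evz f (\<tau> varY)"
    using \<tau>_\<sigma>[of varY] by (simp only: F \<tau>.add \<tau>.mult \<tau>.zpoly[OF \<tau>_Z] evz_Y [symmetric] \<tau>.evz[OF \<tau>_Z])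
  then have "zpoly b * \<tau> varX = varY - evz f (\<tau> varY)" by (simp add: algebra_simps)
  also have "\<dots> \<in> D.loc (\<tau> varY)"
    by (intro D.loc_diff D.loc_evz D.loc_self D.loc_yz yz_vars)
  finally have "\<tau> varX \<in> D.loc (\<tau> varY)" by (rule D.loc_cancel[OF M(2)])
  then have "\<tau> (\<sigma> varX) \<in> D.loc (\<tau> varY)"
    by - (rule D.loc_image, simp_all add: \<tau>.alg_hom_axioms D.loc_self D.loc_yz \<tau>_Z)
  then have "varX \<in> D.loc (\<tau> varY)" by simp
  then show ?thesis using that by (rule D.loc_X)
qed

text \<open>\<open>\<psi> u\<close> fixes \<tau>(y) = c x + q(y) and moves \<open>y\<close> by
  \<open>b u\<close>, so the change of \<open>x\<close> must make up for that of \<open>q\<close>.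
  Thus \<open>\<psi> u\<close> is triangular.\<close>

lemma degree_1_parts:
  assumes F: "\<sigma> varY = zpoly b * varX + [:f:]"
    and q: "\<tau> varY = zpoly c * varX + [:q:]" "c \<noteq> 0" and u: "degree u \<le> 1"
  obtains P where "zpoly c * P = [:q - pcompose q [:b * u, 1:]:]" "P \<in> S" "zpoly (b * u) \<in> S"
proof -
  interpret \<psi>: alg_hom "\<psi> u" by (rule hom[OF \<psi>_H[OF u]])
  have \<psi>Y: "\<psi> u varY = varY + zpoly (b * u)"
  proof -
    have "\<psi> u (\<tau> (\<sigma> varY)) = \<tau> (\<sigma> varY + zpoly (b * u))"
      by (simp only: \<psi>_\<tau> F elem_simps elem_vars elem_yz yz_pCons yz_zpoly)
        (simp add: algebra_simps)
    then show ?thesis by (simp add: \<tau>.zpoly[OF \<tau>_Z])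
  qed
  have "\<psi> u [:q:] = evz q (varY + zpoly (b * u))"
    by (simp only: evz_Y [symmetric] \<psi>.evz[OF \<psi>_Z] \<psi>Y)
  also have "\<dots> = [:pcompose q [:b * u, 1:]:]"
    by (simp only: evz_Y [symmetric] evz_shift add.commute)
  finally have \<psi>q: "\<psi> u [:q:] = [:pcompose q [:b * u, 1:]:]" .
  have "\<psi> u (\<tau> varY) = \<tau> varY" by (simp add: \<psi>_\<tau>)
  then have "zpoly c * \<psi> u varX + [:pcompose q [:b * u, 1:]:] = zpoly c * varX + [:q:]"
    by (simp only: q \<psi>.add \<psi>.mult \<psi>.zpoly[OF \<psi>_Z] \<psi>q)
  then have "zpoly c * (\<psi> u varX - varX) = [:q:] - [:pcompose q [:b * u, 1:]:]"
    by (simp add: right_diff_distrib eq_diff_eq del: diff_pCons)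
      (simp add: algebra_simps del: diff_pCons add_pCons)
  then have P: "zpoly c * (\<psi> u varX - varX) = [:q - pcompose q [:b * u, 1:]:]" by simp
  have yz: "yz (\<psi> u varX - varX)"
    by (rule yz_mult_cancel[of "zpoly c"]) (simp_all only: P yz_pCons zpoly_simps q(2) not_False_eq_True)
  note parts = triangular_parts[OF \<psi>_H[OF u] one_neq_zero one_neq_zero _ yz _ \<psi>_Z, of "b * u"]
  show ?thesis
    by (rule that[OF P]) (rule parts; simp add: \<psi>Y)+
qed

text \<open>For nonconstant \<open>b\<close> the shift \<open>b z\<close> of \<open>y\<close>
  already has degree at least 2. For constant \<open>b\<close> the coefficient \<open>c\<close> is a
  unit as well, and the shape of \<open>q\<close> decides.\<close>

lemma degree_1_case:
  assumes F: "\<sigma> varY = zpoly b * varX + [:f:]" and b: "b \<noteq> 0"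
  shows "TA3 \<subseteq> H"
proof (cases "degree b = 0")
  case False
  interpret D: denominators "- {0 :: 'k poly}" by standard auto
  obtain c q where "c \<noteq> 0" "\<tau> varY = zpoly c * varX + [:q:]"
    by (rule degree_1_inverse[OF F D.denominators_axioms]) (use b in auto)
  then obtain P where "zpoly (b * [:0, 1:]) \<in> S"
    using degree_1_parts[OF F, of c q "[:0, 1:]"] by auto
  moreover have "\<not> lin (zpoly (b * [:0, 1:]))"
    using False b by (intro not_lin_zpoly) (simp add: degree_mult_eq)
  ultimately show ?thesis by (rule TA3_subset)
next
  case True
  then obtain \<beta> where \<beta>: "b = [:\<beta>:]" "\<beta> \<noteq> 0" using b by (auto elim: degree_eq_zeroE)
  have unit: "b dvd 1" using \<beta> by (simp add: is_unit_poly_iff dvd_field_iff)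
  interpret D: denominators "{r :: 'k poly. r dvd 1}" by standard auto
  obtain r c q where c: "r dvd 1" "c dvd r" "\<tau> varY = zpoly c * varX + [:q:]"
    by (rule degree_1_inverse[OF F D.denominators_axioms]) (use unit in auto)
  from c have "c dvd 1" using dvd_trans by blast
  then obtain \<gamma> where \<gamma>: "\<gamma> \<noteq> 0" "zpoly c = const3 \<gamma>" using zpoly_is_unit by blast
  have "c \<noteq> 0" using \<open>c dvd 1\<close> by auto
  let ?D = "pcompose q [:b * [:0, 1:], 1:] - q"
  obtain P where P: "zpoly c * P = [:q - pcompose q [:b * [:0, 1:], 1:]:]" "P \<in> S"
    by (rule degree_1_parts[OF F c(3) \<open>c \<noteq> 0\<close>, of "[:0, 1:]"]) auto
  then have DS: "[:?D:] \<in> S"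
    using S_scale[OF P(2), of "- \<gamma>"] by (simp add: \<gamma>(2) [symmetric])
  show ?thesis
  proof (cases "lin [:?D:]")
    case False
    with DS show ?thesis by (rule TA3_subset)
  next
    case True
    \<comment> \<open>The coefficient of y^k in the difference is a nonzero constant times
      \<open>z\<close> times the leading coefficient of \<open>q\<close>. Linearity thus leaves only
      degree at most 1 in \<open>y\<close>, with a constant coefficient.\<close>
    have "\<exists>q0 l. q = [:q0, [:l:]:]"
    proof (cases "degree q")
      case 0
      then obtain q0 where "q = [:q0:]" by (auto elim: degree_eq_zeroE)
      then have "q = [:q0, [:0:]:]" by simp
      then show ?thesis by blast
    next
      case (Suc k)
      have *: "k = 0 \<and> l = 0" if "coeff (coeff q (Suc k)) l \<noteq> 0" for l
      proof -
        have "coeff ?D k = of_nat (Suc k) * (b * [:0, 1:]) * coeff q (Suc k)"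
          by (rule shift_diff) (simp add: Suc)
        also have "\<dots> = smult (of_nat (Suc k) * \<beta>) (pCons 0 (coeff q (Suc k)))"
          by (simp add: \<beta> of_nat_poly mult.commute del: of_nat_Suc)
        finally have "coeff (coeff ?D k) (Suc l) \<noteq> 0"
          using that \<beta>(2) by (simp del: of_nat_Suc)
        then have "coeff3 [:?D:] 0 k (Suc l) \<noteq> 0" by (simp only: coeff3_yz if_True simp_thms)
        with True have "0 + k + Suc l \<le> 1" unfolding lin_def by blast
        then show ?thesis by simp
      qed
      have "coeff q (Suc k) \<noteq> 0" using Suc leading_coeff_0_iff[of q] by auto
      then have "k = 0" using *[of "degree (coeff q (Suc k))"] by (simp only: leading_coeff_0_iff not_False_eq_True)
      then obtain q0 q1 where q: "q = [:q0, q1:]" using Suc by (metis One_nat_def degree1_coeffs)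
      have "degree q1 = 0"
        using *[of "degree q1"] \<open>k = 0\<close> by (cases "q1 = 0") (simp_all add: q)
      then show ?thesis using q by (auto elim: degree_eq_zeroE)
    qed
    then obtain q0 l where q: "q = [:q0, [:l:]:]" by blast
    \<comment> \<open>Chosen so that \<sigma> composed with \<open>?A\<close> sends \<open>y\<close>
      to \<open>y - q0\<close> and \<open>x\<close> to \<sigma>(y), which is triangular.\<close>
    let ?A = "subst varY (const3 \<gamma> * varX + const3 l * varY) varZ"
    have A: "?A \<in> Aff3"
      by (rule Aff3_subst[where A' = "const3 (inverse \<gamma>) * (varY - const3 l * varX)" and B' = varX
            and C' = varZ]) (simp_all add: \<gamma> lin_intros)
    have "[:q:] = const3 l * varY + zpoly q0"
      by (simp add: q zpoly_def varY_def const3_def)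
    then have Y: "varY = const3 \<gamma> * \<sigma> varX + const3 l * \<sigma> varY + zpoly q0"
      using arg_cong[OF c(3), of \<sigma>] by (simp add: \<gamma> \<sigma>.zpoly[OF Z] add.assoc)
    then have Y': "const3 \<gamma> * \<sigma> varX + const3 l * \<sigma> varY = varY - zpoly q0"
      by (simp add: algebra_simps)
    have F': "\<sigma> varY = const3 \<beta> * varX + [:f:]" using F by (simp add: \<beta> zpoly_const)
    have "\<sigma> \<circ> ?A \<in> H" using A Aff by (intro comp in_H) blast
    note parts = triangular_parts[OF this \<beta>(2) one_neq_zero _ yz_pCons, of f "- q0"]
    have f: "[:f:] \<in> S" by (rule parts) (simp_all add: F' [symmetric] Y' Z)
    have q0: "zpoly (- q0) \<in> S" by (rule parts) (simp_all add: F' [symmetric] Y' Z)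
    have "\<not> (lin [:f:] \<and> lin (zpoly (- q0)))"
    proof (intro notI, elim conjE)
      assume l: "lin [:f:]" "lin (zpoly (- q0))"
      have "lin (\<sigma> varY)" unfolding F' by (intro lin_intros l)
      moreover have "const3 \<gamma> * \<sigma> varX = varY + zpoly (- q0) - const3 l * \<sigma> varY"
        using Y' by (simp add: algebra_simps)
      then have "lin (const3 \<gamma> * \<sigma> varX)"
        by (simp only:) (intro lin_intros l \<open>lin (\<sigma> varY)\<close>)
      ultimately show False using not_lin \<gamma>(1) by (simp add: lin_const_mult_iff)
    qed
    then show ?thesis using f q0 TA3_subset by blast
  qed
qed

end


section \<open>Commutators with translations, and the case of degree at least 2\<close>

context z_aut
begin

text \<open>In the coordinates \<open>G\<close>, \<open>y\<close> over K(z), \<rho> adds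
  \<open>w\<close> to \<open>G\<close> and W(G)/m to \<open>y\<close>. Keeping \<open>m\<close> as a
  fixed denominator leaves \<open>W\<close> in K[z][T].\<close>

definition skew :: "'k poly \<Rightarrow> 'k poly3 \<Rightarrow> 'k poly \<Rightarrow> 'k poly poly \<Rightarrow> ('k poly3 \<Rightarrow> 'k poly3) \<Rightarrow> bool" where
  "skew m G w W \<rho> \<longleftrightarrow> \<rho> \<in> H \<and> \<rho> varZ = varZ \<and> \<rho> G = G + zpoly w
     \<and> zpoly m * (\<rho> varY - varY) = evz W G"

text \<open>The commutator with a translation in \<open>x\<close>, which moves \<open>G\<close> but fixes \<open>y\<close>, replaces \<open>W\<close> by a
  difference of shifts of \<open>W\<close>.\<close>

lemma skew_commutator:
  assumes "skew m G w W \<rho>" and G: "G = zpoly c * varX + [:q:]" and W: "degree W \<le> Suc k"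
    and v: "degree v \<le> 1"
  obtains \<rho>' W' where "skew m G 0 W' \<rho>'" "degree W' \<le> k"
    "coeff W' k = of_nat (Suc k) * (- (c * v)) * coeff W (Suc k)"
proof -
  have \<rho>: "\<rho> \<in> H" "\<rho> varZ = varZ" "\<rho> G = G + zpoly w"
      "zpoly m * \<rho> varY = zpoly m * varY + evz W G"
    using assms(1) by (simp_all add: skew_def algebra_simps)
  define a where "a = inv_into UNIV \<rho>"
  have a: "a \<in> H" unfolding a_def by (rule inv_closed[OF \<rho>(1)])
  interpret \<rho>: alg_hom \<rho> by (rule hom[OF \<rho>(1)])
  interpret a: alg_hom a by (rule hom[OF a])
  have a\<rho>: "a (\<rho> F) = F" for F
    using inv_comp(1)[OF \<rho>(1)] by (simp add: a_def fun_eq_iff)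
  have aZ: "a varZ = varZ" using a\<rho>[of varZ] by (simp add: \<rho>)
  have aG: "a G = G - zpoly w"
    using a\<rho>[of G] by (simp add: \<rho> a.zpoly[OF aZ] algebra_simps)
  let ?T = "\<lambda>v. elem (zpoly v) :: 'k poly3 \<Rightarrow> 'k poly3"
  have TH: "?T v \<in> H" "?T (- v) \<in> H"
    using zpoly_S[of v] zpoly_S[of "- v"] v by (simp_all add: S_def)
  have TG: "?T v G = G + zpoly (c * v)" for v
    by (simp add: G elem_simps distrib_left del: mult_pCons_left mult_pCons_right)
  have Tevz: "?T v (evz W F) = evz W (?T v F)" for v W F
    by (rule alg_hom.evz) (simp_all add: alg_hom_elem)
  \<comment> \<open>Both \<rho> and the translation shift \<open>G\<close> by elements of K[z], so
    these shifts cancel in the commutator and it fixes \<open>G\<close>.\<close>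
  define \<kappa> where "\<kappa> = a \<circ> ?T (- v) \<circ> \<rho> \<circ> ?T v"
  \<comment> \<open>The inverse of \<rho> sends \<open>G\<close> to \<open>G - w\<close>, hence this
    shift by \<open>- w\<close>.\<close>
  define W1 where "W1 = pcompose W [:- w, 1:]"
  define W' where "W' = pcompose W1 [:- (c * v), 1:] - W1"
  have "\<kappa> \<in> H" unfolding \<kappa>_def by (intro comp a TH \<rho>(1))
  moreover have "\<kappa> varZ = varZ" by (simp add: \<kappa>_def \<rho> aZ)
  moreover have "\<kappa> G = G + zpoly 0"
    by (simp only: \<kappa>_def o_apply TG \<rho>.add \<rho>.zpoly[OF \<rho>(2)] \<rho>(3) elem_simps elem_yz yz_zpoly
        a.add a.zpoly[OF aZ] aG) (simp add: algebra_simps)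
  moreover have "zpoly m * (\<kappa> varY - varY) = evz W' G"
  proof -
    have aY: "zpoly m * varY = zpoly m * a varY + evz W (a G)"
      using arg_cong[OF \<rho>(4), of a] by (simp only: a.add a.mult a.zpoly[OF aZ] a.evz[OF aZ] a\<rho>)
    have "\<kappa> varY = a (?T (- v) (\<rho> varY))" by (simp add: \<kappa>_def)
    then have "zpoly m * \<kappa> varY = a (?T (- v) (zpoly m * \<rho> varY))"
      by (simp add: a.zpoly[OF aZ])
    also have "\<dots> = zpoly m * a varY + evz W (a G - zpoly (c * v))"
      unfolding \<rho>(4)
      by (simp only: elem_simps elem_yz yz_zpoly yz_vars Tevz TG a.add a.mult a.zpoly[OF aZ] a.evz[OF aZ])
        simp
    finally have "zpoly m * (\<kappa> varY - varY) = evz W (a G - zpoly (c * v)) - evz W (a G)"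
      using aY by (simp add: algebra_simps)
    also have "\<dots> = evz W' G"
      by (simp add: W'_def W1_def evz_diff evz_shift aG algebra_simps)
    finally show ?thesis .
  qed
  ultimately have "skew m G 0 W' \<kappa>" by (simp add: skew_def)
  \<comment> \<open>The shift by \<open>w\<close> does not affect the coefficient in degree
    \<open>Suc k\<close>.\<close>
  moreover have "degree (W1 - W) \<le> k" unfolding W1_def by (rule shift_diff[OF W])
  then have "coeff (W1 - W) (Suc k) = 0" "degree (W1 - W + W) \<le> Suc k"
    using W coeff_eq_0[of "W1 - W" "Suc k"] degree_add_le[of "W1 - W" "Suc k" W] by linarith+
  then have W1: "coeff W1 (Suc k) = coeff W (Suc k)" "degree W1 \<le> Suc k" by simp_all
  have "degree W' \<le> k" "coeff W' k = of_nat (Suc k) * (- (c * v)) * coeff W (Suc k)"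
    unfolding W'_def W1(1) [symmetric] by (rule shift_diff[OF W1(2)])+
  ultimately show ?thesis using that by blast
qed

text \<open>Each commutator lowers the degree by one and contributes a factor \<open>v\<close>. It
  matters that \<open>N\<close> is chosen before \<open>v\<close>: the same factor then serves for v
  = 1 and v = z.\<close>

lemma skew_iterate:
  assumes G: "G = zpoly c * varX + [:q:]" and c: "c \<noteq> 0"
  shows "\<exists>N. N \<noteq> 0 \<and> (\<forall>v w W \<rho>. skew m G w W \<rho> \<longrightarrow> degree W \<le> Suc k \<longrightarrow> degree v \<le> 1 \<longrightarrow>
    (\<exists>\<rho>'. skew m G 0 [:N * coeff W (Suc k) * v ^ Suc k:] \<rho>'))"
proof (induction k)
  case 0
  have "\<exists>\<rho>'. skew m G 0 [:- c * coeff W (Suc 0) * v ^ Suc 0:] \<rho>'"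
    if W: "skew m G w W \<rho>" "degree W \<le> Suc 0" "degree v \<le> 1" for v w W \<rho>
  proof -
    obtain \<rho>' W' where *: "skew m G 0 W' \<rho>'" "degree W' \<le> 0"
      "coeff W' 0 = of_nat (Suc 0) * (- (c * v)) * coeff W (Suc 0)"
      by (rule skew_commutator[OF W(1) G W(2,3)])
    then have "W' = [:- c * coeff W (Suc 0) * v ^ Suc 0:]"
      by (auto elim!: degree_eq_zeroE simp: mult_ac)
    with * show ?thesis by blast
  qed
  then show ?case using c by (intro exI[of _ "- c"]) simp
next
  case (Suc k)
  then obtain N where N: "N \<noteq> 0" "\<And>v w W \<rho>. skew m G w W \<rho> \<Longrightarrow> degree W \<le> Suc k \<Longrightarrow> degree v \<le> 1 \<Longrightarrow>
    \<exists>\<rho>'. skew m G 0 [:N * coeff W (Suc k) * v ^ Suc k:] \<rho>'" by blast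
  let ?N = "N * (of_nat (Suc (Suc k)) * - c)"
  have "\<exists>\<rho>'. skew m G 0 [:?N * coeff W (Suc (Suc k)) * v ^ Suc (Suc k):] \<rho>'"
    if W: "skew m G w W \<rho>" "degree W \<le> Suc (Suc k)" "degree v \<le> 1" for v w W \<rho>
  proof -
    obtain \<rho>' W' where *: "skew m G 0 W' \<rho>'" "degree W' \<le> Suc k"
      "coeff W' (Suc k) = of_nat (Suc (Suc k)) * (- (c * v)) * coeff W (Suc (Suc k))"
      by (rule skew_commutator[OF W(1) G W(2,3)])
    from N(2)[OF *(1,2) W(3)] obtain \<rho>'' where
      "skew m G 0 [:N * coeff W' (Suc k) * v ^ Suc k:] \<rho>''" by blast
    moreover have "N * coeff W' (Suc k) * v ^ Suc k = ?N * coeff W (Suc (Suc k)) * v ^ Suc (Suc k)"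
      by (simp add: *(3) mult_ac del: of_nat_Suc)
    ultimately show ?thesis by auto
  qed
  moreover have "?N \<noteq> 0" using N(1) c by (simp del: of_nat_Suc)
  ultimately show ?case by blast
qed

lemma degree_ge_2_case:
  assumes F: "zpoly m * \<sigma> varY = zpoly n * varY + evz Q (zpoly p * varX + [:q:])"
    and nz: "m \<noteq> 0" "n \<noteq> 0" "p \<noteq> 0" and Q: "degree Q = Suc (Suc k)"
  shows "TA3 \<subseteq> H"
proof -
  let ?g = "zpoly p * varX + [:q:]"
  define G where "G = \<tau> ?g"
  have G: "G = zpoly p * \<tau> varX + evz q (\<tau> varY)"
    unfolding G_def by (simp only: \<tau>.add \<tau>.mult \<tau>.zpoly[OF \<tau>_Z] evz_Y [symmetric] \<tau>.evz[OF \<tau>_Z])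
  have Y: "zpoly m * varY = zpoly n * \<tau> varY + evz Q G"
    using arg_cong[OF F, of \<tau>]
    by (simp only: \<tau>.add \<tau>.mult[of "zpoly m"] \<tau>.mult[of "zpoly n"] \<tau>.zpoly[OF \<tau>_Z] \<tau>.evz[OF \<tau>_Z] \<tau>_\<sigma> G_def)
  \<comment> \<open>Over K(z) the equations \<open>Y\<close> and \<open>G\<close> are solved for
    \<tau>(y) and then \<tau>(x), so x = \<tau>(\<sigma>(x)) becomes a polynomial in
    \<open>G\<close> and \<open>y\<close>.\<close>
  interpret D: denominators "- {0 :: 'k poly}" by standard auto
  have "zpoly n * \<tau> varY = zpoly m * varY - evz Q G" using Y by (simp add: algebra_simps)
  also have "\<dots> \<in> D.loc G"
    by (intro D.loc_diff D.loc_evz D.loc_self D.loc_yz yz_ring(3) yz_vars yz_zpoly)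
  finally have locY: "\<tau> varY \<in> D.loc G" by (rule D.loc_cancel[rotated]) (use nz in simp)
  have "zpoly p * \<tau> varX = G - evz q (\<tau> varY)" using G by (simp add: algebra_simps)
  also have "\<dots> \<in> D.loc G"
    by (intro D.loc_diff D.loc_evz D.loc_self locY)
  finally have locX: "\<tau> varX \<in> D.loc G" by (rule D.loc_cancel[rotated]) (use nz in simp)
  have "\<tau> (\<sigma> varX) \<in> D.loc G"
    by (rule D.loc_image) (simp_all add: \<tau>.alg_hom_axioms locX locY D.loc_yz \<tau>_Z)
  then have "varX \<in> D.loc G" by simp
  then obtain c q' where c: "c \<noteq> 0" and G': "G = zpoly c * varX + [:q':]"
    by (rule D.loc_X)
  \<comment> \<open>\<open>\<psi> u\<close> fixes \<tau>(y), so applying it to \<open>Y\<close>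
    expresses the change of \<open>y\<close> by a difference of \<open>Q\<close> alone.\<close>
  have start: "skew m G (p * u) (pcompose Q [:p * u, 1:] - Q) (\<psi> u)" if u: "degree u \<le> 1" for u
  proof -
    have g: "elem (zpoly u) ?g = ?g + zpoly (p * u)"
      by (simp add: elem_simps distrib_left del: mult_pCons_left mult_pCons_right)
    interpret \<psi>: alg_hom "\<psi> u" by (rule hom[OF \<psi>_H[OF u]])
    interpret E: alg_hom "elem (zpoly u)" by (rule alg_hom_elem)
    have \<psi>G: "\<psi> u G = G + zpoly (p * u)"
      unfolding G_def \<psi>_\<tau> g by (simp only: \<tau>.add \<tau>.zpoly[OF \<tau>_Z])
    have "\<psi> u (zpoly n * \<tau> varY) = zpoly n * \<tau> varY"
      by (simp add: \<psi>.zpoly[OF \<psi>_Z] \<psi>_\<tau>)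
    then have "zpoly m * \<psi> u varY = zpoly n * \<tau> varY + evz Q (G + zpoly (p * u))"
      using arg_cong[OF Y, of "\<psi> u"]
      by (simp only: \<psi>.add \<psi>.mult[of "zpoly m"] \<psi>.zpoly[OF \<psi>_Z] \<psi>.evz[OF \<psi>_Z] \<psi>G)
    then have "zpoly m * (\<psi> u varY - varY) = evz (pcompose Q [:p * u, 1:] - Q) G"
      using Y by (simp add: evz_diff evz_shift right_diff_distrib add.commute)
    then show ?thesis using \<psi>_H[OF u] \<psi>_Z \<psi>G by (simp add: skew_def)
  qed
  obtain N where N: "N \<noteq> 0" "\<And>v w W \<rho>. skew m G w W \<rho> \<Longrightarrow> degree W \<le> Suc k \<Longrightarrow> degree v \<le> 1 \<Longrightarrow>
      \<exists>\<rho>'. skew m G 0 [:N * coeff W (Suc k) * v ^ Suc k:] \<rho>'"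
    using skew_iterate[OF G' c, of m k] by blast
  \<comment> \<open>With u = v in \<open>start\<close>, the initial difference gives one factor
    \<open>v\<close> and the commutators give \<open>Suc k\<close> more; the total exponent is the
    degree of \<open>Q\<close>.\<close>
  define N1 where "N1 = N * (of_nat (Suc (Suc k)) * p * coeff Q (Suc (Suc k)))"
  have "coeff Q (Suc (Suc k)) \<noteq> 0" using Q leading_coeff_0_iff[of Q] by auto
  then have N1: "N1 \<noteq> 0" using N(1) nz by (simp add: N1_def del: of_nat_Suc)
  have ex: "\<exists>\<rho>. skew m G 0 [:N1 * v ^ Suc (Suc k):] \<rho>" if v: "degree v \<le> 1" for v
  proof -
    let ?W = "pcompose Q [:p * v, 1:] - Q"
    have W: "degree ?W \<le> Suc k"
      "coeff ?W (Suc k) = of_nat (Suc (Suc k)) * (p * v) * coeff Q (Suc (Suc k))"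
      by (rule shift_diff; simp add: Q)+
    have "N * coeff ?W (Suc k) * v ^ Suc k = N1 * v ^ Suc (Suc k)"
      unfolding W(2) by (simp add: N1_def mult_ac del: of_nat_Suc)
    with N(2)[OF start[OF v] W(1) v] show ?thesis by (simp only:)
  qed
  have diff: "zpoly m * (\<rho> varY - varY) = zpoly (N1 * v ^ Suc (Suc k))"
    if "skew m G 0 [:N1 * v ^ Suc (Suc k):] \<rho>" for v \<rho>
    using that by (simp add: skew_def)
  \<comment> \<open>v = 1 only serves to show that \<open>m\<close> divides \<open>N1\<close>,
    because the change of \<open>y\<close> is a polynomial.\<close>
  obtain \<rho>1 where \<rho>1: "skew m G 0 [:N1 * 1 ^ Suc (Suc k):] \<rho>1" using ex[of 1] by auto
  have "zpoly m * (\<rho>1 varY - varY) = zpoly N1" using diff[OF \<rho>1] by (simp only: power_one mult_1_right)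
  then obtain b where b: "N1 = m * b" using zpoly_coeff by metis
  then have "b \<noteq> 0" using N1 by auto
  let ?b = "b * [:0, 1:] ^ Suc (Suc k)"
  obtain \<rho> where \<rho>: "skew m G 0 [:N1 * [:0, 1:] ^ Suc (Suc k):] \<rho>" using ex[of "[:0, 1:]"] by auto
  then have H: "\<rho> \<in> H" and Z: "\<rho> varZ = varZ" and \<rho>G: "\<rho> G = G" by (simp_all add: skew_def)
  interpret \<rho>: alg_hom \<rho> by (rule hom[OF H])
  have "zpoly m * (\<rho> varY - varY) = zpoly m * zpoly ?b"
    unfolding diff[OF \<rho>] b by (simp only: zpoly_simps(6) mult.assoc)
  then have "\<rho> varY - varY = zpoly ?b" using nz by (simp only: mult_cancel_left zpoly_simps) simp
  then have \<rho>Y: "\<rho> varY = const3 1 * varY + zpoly ?b" by (simp only: const3_simps mult_1) (metis diff_add_cancel add.commute)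
  \<comment> \<open>Since \<rho> fixes \<open>G\<close> and maps K[y,z] into itself, the change of
    \<open>x\<close> is free of \<open>x\<close>; so \<rho> is triangular.\<close>
  have "zpoly c * (\<rho> varX - varX) = [:q':] - \<rho> [:q':]"
    using \<rho>G by (simp only: G' \<rho>.add \<rho>.mult \<rho>.zpoly[OF Z]) (simp only: algebra_simps)
  moreover have "yz (\<rho> [:q':])"
    by (rule \<rho>.yz_image) (simp_all only: \<rho>Y Z yz_ring yz_const yz_vars yz_zpoly yz_pCons)
  ultimately have "yz (zpoly c * (\<rho> varX - varX))" by (simp only: yz_ring yz_pCons)
  then have yz: "yz (\<rho> varX - varX)" by (rule yz_mult_cancel) (use c in simp)
  have "zpoly ?b \<in> S"
    by (rule triangular_parts(2)[OF H one_neq_zero one_neq_zero _ yz \<rho>Y Z]) simp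
  moreover have "degree ?b = degree b + Suc (Suc k)"
    using \<open>b \<noteq> 0\<close> by (simp add: degree_mult_eq degree_power_eq del: power_Suc)
  then have "\<not> lin (zpoly ?b)" by (intro not_lin_zpoly) simp
  ultimately show ?thesis by (rule TA3_subset)
qed

lemma R2_TA3:
  assumes "\<sigma> varY \<in> R2"
  shows "TA3 \<subseteq> H"
proof -
  obtain m n p q Q where nz: "m \<noteq> 0" "p \<noteq> 0" "n \<noteq> 0"
    and F: "zpoly m * \<sigma> varY = zpoly n * varY + evz Q (zpoly p * varX + [:q:])"
    by (rule R2_cleared[OF assms])
  consider "degree Q = 0" | "degree Q = 1" | k where "degree Q = Suc (Suc k)"
    by (metis One_nat_def nat.exhaust)
  then show ?thesis
  proof cases
    case 1
    then obtain r where "Q = [:r:]" by (rule degree_eq_zeroE)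
    with F have "zpoly m * \<sigma> varY = zpoly n * varY + zpoly r" by simp
    then show ?thesis using nz(1) by (rule degree_0_case)
  next
    case 2
    then obtain r0 r1 where Q: "Q = [:r0, r1:]" by (metis One_nat_def degree1_coeffs)
    with 2 have "r1 \<noteq> 0" by auto
    \<comment> \<open>\<sigma>(y) is split as f0 + b x + F1 x^2. Comparing coefficients of
      \<open>x\<close> in the cleared identity gives F1 = 0 and \<open>b\<close> of degree 0 in
      \<open>y\<close>.\<close>
    obtain f0 F0 where "\<sigma> varY = pCons f0 F0" by (rule pCons_cases)
    moreover obtain b F1 where "F0 = pCons b F1" by (rule pCons_cases)
    ultimately have split: "\<sigma> varY = pCons f0 (pCons b F1)" by simp
    have "pCons ([:m:] * f0) (pCons ([:m:] * b) ([:[:m:]:] * F1)) = zpoly m * \<sigma> varY"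
      by (simp add: split zpoly_def)
    also have "\<dots> = [:[:r0, n:] + smult r1 q, [:r1 * p:]:]"
      unfolding F by (simp add: Q zpoly_def varX_def varY_def)
    finally have "[:m:] * b = [:r1 * p:]" "[:[:m:]:] * F1 = 0" by simp_all
    then have "F1 = 0" "b \<noteq> 0" using nz \<open>r1 \<noteq> 0\<close> by auto
    have "degree ([:m:] * b) = degree b" using nz by simp
    then have "degree b = 0" using \<open>[:m:] * b = [:r1 * p:]\<close> by (simp only: degree_pCons_0)
    then obtain b' where b: "b = [:b':]" "b' \<noteq> 0"
      using \<open>b \<noteq> 0\<close> by (auto elim: degree_eq_zeroE)
    have "\<sigma> varY = zpoly b' * varX + [:f0:]"
      by (simp add: split \<open>F1 = 0\<close> b zpoly_def varX_def)
    then show ?thesis using b(2) by (rule degree_1_case)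
  next
    case 3
    show ?thesis by (rule degree_ge_2_case[OF F nz(1,3,2) 3])
  qed
qed

end

theorem theorem12:
  fixes \<sigma> :: "'k::field_char_0 poly3 \<Rightarrow> 'k poly3"
  assumes "\<sigma> \<in> carrier GA3 - Aff3"
    and "\<sigma> varZ = varZ"
    and "\<sigma> varY \<in> R2"
  shows "co_tame \<sigma>"
proof -
  let ?H = "generate GA3 (insert \<sigma> Aff3)"
  have "insert \<sigma> Aff3 \<subseteq> carrier GA3" using assms(1) by (auto simp: Aff3_def)
  then have "subgroup ?H GA3" by (rule group.generate_is_subgroup[OF group_GA3])
  moreover have "insert \<sigma> Aff3 \<subseteq> ?H" by (auto intro: generate.incl)
  ultimately interpret z_aut ?H \<sigma>
    by (intro z_aut.intro overgroup.intro z_aut_axioms.intro) (use assms in auto)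
  show ?thesis
    using R2_TA3[OF assms(3)] assms(1) by (simp add: co_tame_def)
qed

end
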